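(* Let $a,b\in C([0,1],\mathbb C)$, $Lw=w''+a(x)w'+b(x)w$, $d,d^*\in L^2((0,1),\mathbb C)$, $p_0,p_1,p_0^*,p_1^*\in\mathbb C$, $\alpha\in(0,1)$ and $\delta\in(0,1)$. Suppose that there exists $w^*\in H^3(0,1)$ (complex valued) such that $Lw^*=d^*$ in $(0,1)$, $w^*(0)=p_0^*$, $(w^* )'(0)=p_1^*$, $(w^* )'(1)=0$, and that $$\max\left\{\|d-d^*\|_{L^2(0,1)},\ |p_0-p_0^*|,\ |p_1-p_1^*|\right\}\le\delta .$$ Let $w_\alpha\in W$ be the unique minimizer over $W$ of the functional $J_\alpha$ (with data $d,p_0,p_1$). Then there exists a constant $C_2>0$ depending only on $\|a\|_{L^\infty(0,1)}$ and $\|b\|_{L^\infty(0,1)}$ such that $$\|w_\alpha-w^*\|_{H^2(0,1)}\le C_2\left(\delta+\sqrt\alpha+\sqrt\alpha\,\|w^*\|_{H^3(0,1)}\right).$$ In particular, if $\alpha=\delta^2$, then (with a different constant $C_2$, depending on the same quantities) $$\|w_\alpha-w^*\|_{H^2(0,1)}\le C_2\left(1+\|w^*\|_{H^3(0,1)}\right)\delta .$$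
   Context: All functions are complex valued. $W=\{w\in H^3(0,1): w(0)=p_0,\ w'(0)=p_1,\ w'(1)=0\}$ and $$J_\alpha(w)=\frac12\left(\|Lw-d\|_{L^2(0,1)}^2+\alpha\|w\|_{H^3(0,1)}^2\right),\qquad w\in W .$$ For every $\alpha\in(0,1)$ the functional $J_\alpha$ has a unique minimizer on $W$. *)

theory Defs
  imports "HOL-Analysis.Analysis" "HOL-Probability.Essential_Supremum"
begin

section \<open>Complex-valued Lebesgue and Sobolev spaces on the unit interval\<close>

text \<open>Elements of the spaces are represented by functions on the real line, of which only the
  restriction to the open unit interval, up to null sets, matters.\<close>

abbreviation I01 :: "real measure" where
  "I01 \<equiv> lebesgue_on {0<..<1}"

definition L2 :: "(real \<Rightarrow> complex) set" where
  "L2 = {u. u \<in> borel_measurable I01 \<and> integrable I01 (\<lambda>x. (cmod (u x))\<^sup>2)}"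

definition L2_norm :: "(real \<Rightarrow> complex) \<Rightarrow> real" where
  "L2_norm u = sqrt (LINT x|I01. (cmod (u x))\<^sup>2)"

definition Linf_norm :: "(real \<Rightarrow> complex) \<Rightarrow> real" where
  "Linf_norm u = real_of_ereal (esssup I01 (\<lambda>x. ereal (cmod (u x))))"

text \<open>Real-valued test functions suffice for complex-valued \<open>u\<close>: the identity defining weak
  derivatives is complex linear in the test function.\<close>

definition test_fun :: "(real \<Rightarrow> real) \<Rightarrow> bool" where
  "test_fun \<phi> \<longleftrightarrow> (\<forall>k. (deriv ^^ k) \<phi> differentiable_on UNIV)
     \<and> compact (closure {x. \<phi> x \<noteq> 0}) \<and> closure {x. \<phi> x \<noteq> 0} \<subseteq> {0<..<1}"

text \<open>Used only for \<open>u\<close> and \<open>v\<close> in \<^const>\<open>L2\<close>, so that both integrals exist.\<close>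

definition is_weak_deriv :: "nat \<Rightarrow> (real \<Rightarrow> complex) \<Rightarrow> (real \<Rightarrow> complex) \<Rightarrow> bool" where
  "is_weak_deriv k u v \<longleftrightarrow> (\<forall>\<phi>. test_fun \<phi> \<longrightarrow>
     (LINT x|I01. (deriv ^^ k) \<phi> x *\<^sub>R u x) = (-1) ^ k * (LINT x|I01. \<phi> x *\<^sub>R v x))"

definition H :: "nat \<Rightarrow> (real \<Rightarrow> complex) set" where
  "H m = {u \<in> L2. \<forall>k\<le>m. \<exists>v\<in>L2. is_weak_deriv k u v}"

text \<open>The choice is unique up to null sets.\<close>

definition weak_deriv :: "nat \<Rightarrow> (real \<Rightarrow> complex) \<Rightarrow> (real \<Rightarrow> complex)" where
  "weak_deriv k u = (SOME v. v \<in> L2 \<and> is_weak_deriv k u v)"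

definition H_norm :: "nat \<Rightarrow> (real \<Rightarrow> complex) \<Rightarrow> real" where
  "H_norm m u = sqrt (\<Sum>k\<le>m. (L2_norm (weak_deriv k u))\<^sup>2)"

text \<open>Point values of Sobolev functions, including those at the end points, are the values of the
  continuous representative on the closed interval; that representative exists for all functions
  in \<open>H 1\<close> and is unique on the closed interval.\<close>

definition cont_rep :: "(real \<Rightarrow> complex) \<Rightarrow> (real \<Rightarrow> complex)" where
  "cont_rep u = (SOME g. continuous_on {0..1} g \<and> (AE x in I01. g x = u x))"

section \<open>The differential operator and the regularised functional\<close>

definition L_op :: "(real \<Rightarrow> complex) \<Rightarrow> (real \<Rightarrow> complex) \<Rightarrow> (real \<Rightarrow> complex) \<Rightarrow> real \<Rightarrow> complex" where
  "L_op a b w = (\<lambda>x. weak_deriv 2 w x + a x * weak_deriv 1 w x + b x * w x)"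

definition W :: "complex \<Rightarrow> complex \<Rightarrow> (real \<Rightarrow> complex) set" where
  "W p0 p1 = {w \<in> H 3. cont_rep w 0 = p0 \<and> cont_rep (weak_deriv 1 w) 0 = p1
     \<and> cont_rep (weak_deriv 1 w) 1 = 0}"

definition J :: "(real \<Rightarrow> complex) \<Rightarrow> (real \<Rightarrow> complex) \<Rightarrow> (real \<Rightarrow> complex) \<Rightarrow> real
    \<Rightarrow> (real \<Rightarrow> complex) \<Rightarrow> real" where
  "J a b d \<alpha> w = 1/2 * ((L2_norm (\<lambda>x. L_op a b w x - d x))\<^sup>2 + \<alpha> * (H_norm 3 w)\<^sup>2)"

end

theory Submission
  imports Defs
begin

text \<open>The error \<open>v = w\<alpha> - ws\<close> solves a second order initial value problem with small data, and
  initial value problems are stable in \<open>H 2\<close>.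

  The initial values of \<open>v\<close> are \<open>p0 - p0s\<close> and \<open>p1 - p1s\<close>, of size at most \<open>\<delta>\<close>. That the right-hand
  side \<open>L v = (L w\<alpha> - d) + (d - ds)\<close> is small in \<open>L2\<close> follows by comparing \<open>w\<alpha>\<close> with a competitor.
  The function \<open>ws\<close> itself has the wrong boundary values, so a quadratic polynomial \<open>q\<close> with
  \<open>q(0) = p0 - p0s\<close>, \<open>q'(0) = p1 - p1s\<close> and \<open>q'(1) = 0\<close> is added to it; all its Sobolev norms are
  \<open>O(\<delta>)\<close>. Then \<open>J w\<alpha> \<le> J (ws + q)\<close> bounds \<open>L w\<alpha> - d\<close> by a multiple of
  \<open>\<delta> + sqrt \<alpha> * H_norm 3 ws\<close> (lemma \<open>minimizer_residual_bound\<close>).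

  For the stability estimate, the sum \<open>|v| + |v'|\<close> satisfies an integral inequality whose
  kernel is controlled by the sup norms of \<open>a\<close> and \<open>b\<close>, so it is bounded by Gronwall's inequality;
  the equation then bounds \<open>v''\<close> (lemma \<open>ODE_stability\<close>). With \<open>A\<close> and \<open>B\<close> denoting the sup norms
  of \<open>a\<close> and \<open>b\<close>, Gronwall's inequality contributes the factor \<open>exp (1 + A + B)\<close> to the constant.

  Both steps treat Sobolev functions as absolutely continuous functions. That weak derivatives
  are unique and linear up to null sets, and that a function with a weak derivative \<open>v\<close> in \<open>L2\<close> is a
  constant plus the integral of \<open>v\<close>, are the theorems \<open>fundamental_lemma\<close> and
  \<open>du_Bois_Reymond\<close>; they rest on smooth bump functions converging to indicators of intervals
  and on Fubini's theorem. Estimates of \<open>L2\<close> norms are kept in squared form, where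
  \<open>|x + y|^2 \<le> 2 |x|^2 + 2 |y|^2\<close> takes the place of Minkowski's inequality; only the numerical
  constants are affected.\<close>

section \<open>Smooth functions and test functions\<close>

text \<open>Existence of \<open>n\<close> successive derivatives, given by recursion on \<open>n\<close> so that products are
  handled by induction without the Leibniz formula for higher derivatives.\<close>

primrec ndiff :: "nat \<Rightarrow> (real \<Rightarrow> real) \<Rightarrow> bool" where
  "ndiff 0 f \<longleftrightarrow> True"
| "ndiff (Suc n) f \<longleftrightarrow> (\<exists>f'. (\<forall>x. (f has_real_derivative f' x) (at x)) \<and> ndiff n f')"

lemma ndiff_Suc_iff_deriv:
  "ndiff (Suc n) f \<longleftrightarrow> f differentiable_on UNIV \<and> ndiff n (deriv f)"
proof
  assume "ndiff (Suc n) f"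
  then obtain f' where f': "\<And>x. (f has_real_derivative f' x) (at x)" "ndiff n f'" by auto
  then have "deriv f = f'" by (auto intro: DERIV_imp_deriv)
  moreover have "f differentiable_on UNIV"
    using f'(1) by (auto simp: differentiable_on_def real_differentiable_def)
  ultimately show "f differentiable_on UNIV \<and> ndiff n (deriv f)" using f' by simp
next
  assume "f differentiable_on UNIV \<and> ndiff n (deriv f)"
  then show "ndiff (Suc n) f"
    by (auto simp: differentiable_on_def real_differentiable_def
        intro!: exI[of _ "deriv f"] dest: DERIV_imp_deriv)
qed

lemma all_ndiff_iff: "(\<forall>n. ndiff n f) \<longleftrightarrow> (\<forall>k. (deriv ^^ k) f differentiable_on UNIV)"
proof
  assume *: "\<forall>n. ndiff n f"
  have "ndiff n ((deriv ^^ k) f)" for k n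
  proof (induction k arbitrary: n)
    case (Suc k)
    from Suc[of "Suc n"] show ?case by (simp only: ndiff_Suc_iff_deriv) simp
  qed (use * in auto)
  then show "\<forall>k. (deriv ^^ k) f differentiable_on UNIV"
    using ndiff_Suc_iff_deriv by blast
next
  assume *: "\<forall>k. (deriv ^^ k) f differentiable_on UNIV"
  have "ndiff n ((deriv ^^ k) f)" for k n
  proof (induction n arbitrary: k)
    case (Suc n)
    from Suc[of "Suc k"] * show ?case by (simp only: ndiff_Suc_iff_deriv) simp
  qed auto
  from this[of _ 0] show "\<forall>n. ndiff n f" by simp
qed

lemma ndiff_SucD: "ndiff (Suc n) f \<Longrightarrow> ndiff n f"
  by (induction n arbitrary: f) auto

lemma ndiff_add: "ndiff n f \<Longrightarrow> ndiff n g \<Longrightarrow> ndiff n (\<lambda>x. f x + g x)"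
proof (induction n arbitrary: f g)
  case (Suc n)
  then obtain f' g' where "\<forall>x. (f has_real_derivative f' x) (at x)" "ndiff n f'"
    "\<forall>x. (g has_real_derivative g' x) (at x)" "ndiff n g'" by auto
  with Suc.IH show ?case
    by (auto intro!: exI[of _ "\<lambda>x. f' x + g' x"] derivative_eq_intros)
qed auto

lemma ndiff_mult: "ndiff n f \<Longrightarrow> ndiff n g \<Longrightarrow> ndiff n (\<lambda>x. f x * g x)"
proof (induction n arbitrary: f g)
  case (Suc n)
  then obtain f' g' where *: "\<And>x. (f has_real_derivative f' x) (at x)" "ndiff n f'"
    "\<And>x. (g has_real_derivative g' x) (at x)" "ndiff n g'" by auto
  have "ndiff n (\<lambda>x. f' x * g x + f x * g' x)"
    by (intro ndiff_add Suc.IH * Suc.prems[THEN ndiff_SucD])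
  then show ?case
    by (auto intro!: exI[of _ "\<lambda>x. f' x * g x + f x * g' x"] derivative_eq_intros *)
qed auto

lemma ndiff_const: "ndiff n (\<lambda>x. c)"
proof (induction n arbitrary: c)
  case (Suc n)
  then show ?case by (auto intro!: exI[of _ "\<lambda>_. 0"])
qed auto

lemma ndiff_affine: "ndiff n f \<Longrightarrow> ndiff n (\<lambda>x. f (c * x + e))"
proof (induction n arbitrary: f)
  case (Suc n)
  then obtain f' where *: "\<And>x. (f has_real_derivative f' x) (at x)" "ndiff n f'" by auto
  have "((\<lambda>x. f (c * x + e)) has_real_derivative c * f' (c * x + e)) (at x)" for x
  proof -
    have "((\<lambda>x. c * x + e) has_real_derivative c) (at x)"
      by (auto intro!: derivative_eq_intros)
    from DERIV_chain2[OF *(1) this] show ?thesis by (simp add: mult.commute)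
  qed
  moreover have "ndiff n (\<lambda>x. c * f' (c * x + e))"
    by (intro ndiff_mult ndiff_const Suc.IH *)
  ultimately show ?case
    by (auto intro!: exI[of _ "\<lambda>x. c * f' (c * x + e)"])
qed auto

text \<open>For \<open>p = 1\<close> this is the standard smooth function that is flat at the origin; the polynomial
  factor makes the family closed under differentiation.\<close>

definition flat :: "real poly \<Rightarrow> real \<Rightarrow> real" where
  "flat p x = (if x > 0 then poly p (1 / x) * exp (- (1 / x)) else 0)"

lemma poly_times_exp_minus_tendsto_0: "((\<lambda>y::real. poly p y * exp (- y)) \<longlongrightarrow> 0) at_top"
proof -
  have "((\<lambda>y. \<Sum>i\<le>degree p. coeff p i * (y ^ i / exp y)) \<longlongrightarrow> (\<Sum>i\<le>degree p. coeff p i * 0)) at_top"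
    by (intro tendsto_intros tendsto_power_div_exp_0)
  then show ?thesis
    by (simp add: poly_altdef sum_distrib_right exp_minus divide_inverse mult.assoc)
qed

text \<open>At the origin, \<open>y = 1 / x\<close> turns the difference quotient into a polynomial times
  \<open>exp (- y)\<close>, which tends to zero as \<open>y\<close> grows.\<close>

lemma flat_has_derivative:
  "(flat p has_real_derivative flat (monom 1 2 * (p - pderiv p)) x) (at x)"
proof -
  consider "x > 0" | "x < 0" | "x = 0" by linarith
  then show ?thesis
  proof cases
    case 1
    have "((\<lambda>x. poly p (1 / x) * exp (- (1 / x))) has_real_derivative
        flat (monom 1 2 * (p - pderiv p)) x) (at x)"
      using 1 by (auto intro!: derivative_eq_intros
          simp: flat_def poly_monom field_simps power2_eq_square)
    then show ?thesis
      by (rule has_field_derivative_transform_within_open[where S="{0<..}"])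
        (use 1 in \<open>auto simp: flat_def\<close>)
  next
    case 2
    have "((\<lambda>x. 0) has_real_derivative flat (monom 1 2 * (p - pderiv p)) x) (at x)"
      using 2 by (auto simp: flat_def)
    then show ?thesis
      by (rule has_field_derivative_transform_within_open[where S="{..<0}"])
        (use 2 in \<open>auto simp: flat_def\<close>)
  next
    case 3
    have "((\<lambda>y. flat p y / y) \<longlongrightarrow> 0) (at_left 0)"
      by (rule tendsto_eventually) (auto simp: flat_def eventually_at_filter)
    moreover have "((\<lambda>y. flat p y / y) \<longlongrightarrow> 0) (at_right 0)"
      unfolding filterlim_at_right_to_top
    proof (rule Lim_transform_eventually)
      show "((\<lambda>y. poly (monom 1 1 * p) y * exp (- y)) \<longlongrightarrow> 0) at_top"
        by (rule poly_times_exp_minus_tendsto_0)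
      show "\<forall>\<^sub>F y in at_top. poly (monom 1 1 * p) y * exp (- y) = flat p (inverse y) / inverse y"
        using eventually_gt_at_top[of 0]
        by eventually_elim (auto simp: flat_def poly_monom field_simps)
    qed
    ultimately have "((\<lambda>y. flat p y / y) \<longlongrightarrow> 0) (at 0)"
      by (rule filterlim_split_at)
    then show ?thesis
      using 3 by (simp add: has_field_derivative_iff flat_def)
  qed
qed

lemma ndiff_flat: "ndiff n (flat p)"
  by (induction n arbitrary: p) (auto intro!: flat_has_derivative)

text \<open>As \<open>n\<close> grows, \<open>exp (- 1 / ((n + 1) (x - a)))\<close> tends to 1 for every \<open>x > a\<close>, and likewise at \<open>b\<close>,
  so this product tends pointwise to the indicator of the interval while remaining smooth and supported in it.\<close>

definition bump :: "real \<Rightarrow> real \<Rightarrow> nat \<Rightarrow> real \<Rightarrow> real" where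
  "bump a b n x = flat 1 (real (Suc n) * x + - real (Suc n) * a) * flat 1 (- real (Suc n) * x + real (Suc n) * b)"

lemma bump_nonzero: "bump a b n x \<noteq> 0 \<longleftrightarrow> a < x \<and> x < b"
proof -
  have "real (Suc n) * a < real (Suc n) * x \<longleftrightarrow> a < x" "real (Suc n) * x < real (Suc n) * b \<longleftrightarrow> x < b"
    by (subst mult_less_cancel_left_pos; simp)+
  moreover have "0 < real (Suc n) * x + - real (Suc n) * a \<longleftrightarrow> real (Suc n) * a < real (Suc n) * x"
    "0 < - real (Suc n) * x + real (Suc n) * b \<longleftrightarrow> real (Suc n) * x < real (Suc n) * b"
    by (simp_all only: mult_minus_left) linarith+
  ultimately show ?thesis unfolding bump_def flat_def by simp
qed

lemma bump_bounds: "0 \<le> bump a b n x" "bump a b n x \<le> 1"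
  by (auto simp: bump_def flat_def intro!: mult_le_one)

lemma bump_tendsto_indicator: "(\<lambda>n. bump a b n x) \<longlonglongrightarrow> indicator {a<..<b} x"
proof (cases "a < x \<and> x < b")
  case True
  have *: "(\<lambda>n. exp (- (1 / (real (Suc n) * c)))) \<longlonglongrightarrow> exp (- 0)" if "c > 0" for c :: real
    using LIMSEQ_inverse_real_of_nat[THEN tendsto_mult_right, of "1/c"]
    by (intro tendsto_intros) (simp add: field_simps)
  have "bump a b n x = exp (- (1 / (real (Suc n) * (x - a)))) * exp (- (1 / (real (Suc n) * (b - x))))" for n
  proof -
    have "real (Suc n) * (x - a) > 0" "real (Suc n) * (b - x) > 0" using True by simp_all
    then show ?thesis by (simp add: bump_def flat_def algebra_simps)
  qed
  with tendsto_mult[OF *[of "x - a"] *[of "b - x"]] True show ?thesis by simp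
next
  case False
  then show ?thesis using bump_nonzero[of a b _ x] by (auto simp: indicator_def)
qed

lemma test_fun_ndiffI:
  assumes "\<And>n. ndiff n f" "0 < a" "b < 1" "\<And>x. f x \<noteq> 0 \<Longrightarrow> a \<le> x \<and> x \<le> b"
  shows "test_fun f"
proof -
  have "closure {x. f x \<noteq> 0} \<subseteq> {a..b}"
    using assms by (intro closure_minimal) auto
  moreover from this have "compact (closure {x. f x \<noteq> 0})"
    by (metis bounded_closed_interval bounded_subset closed_closure compact_eq_bounded_closed)
  ultimately show ?thesis
    using assms all_ndiff_iff[of f] by (auto simp: test_fun_def dest!: subsetD)
qed

text \<open>The support is a compact subset of the open interval and hence stays away from the end
  points.\<close>

lemma test_funE:
  assumes "test_fun f"
  obtains a b where "0 < a" "a < b" "b < 1" "\<And>x. f x \<noteq> 0 \<Longrightarrow> a \<le> x \<and> x \<le> b"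
proof -
  \<comment> \<open>The point 1/2 keeps the infimum and the supremum meaningful when the function is zero.\<close>
  define S where "S = insert (1/2) (closure {x. f x \<noteq> 0})"
  have S: "compact S" "S \<noteq> {}" "S \<subseteq> {0<..<1}"
    using assms by (auto simp: test_fun_def S_def)
  have bdd: "bdd_below S" "bdd_above S"
    using S(1) by (auto intro: bounded_imp_bdd_below bounded_imp_bdd_above compact_imp_bounded)
  have "Inf S \<in> S" "Sup S \<in> S"
    using S bdd by (auto intro!: closed_contains_Inf closed_contains_Sup compact_imp_closed)
  then have *: "0 < Inf S" "Inf S < 1" "0 < Sup S" "Sup S < 1" using S(3) by auto
  have IS: "Inf S \<le> x \<and> x \<le> Sup S" if "f x \<noteq> 0" for x
  proof -
    have "x \<in> S" using that closure_subset[of "{x. f x \<noteq> 0}"] by (auto simp: S_def)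
    then show ?thesis using bdd by (auto intro: cInf_lower cSup_upper)
  qed
  have "Inf S / 2 \<le> x \<and> x \<le> (1 + Sup S) / 2" if "f x \<noteq> 0" for x
    using IS[OF that] * by auto
  moreover have "Inf S / 2 < (1 + Sup S) / 2" using * by auto
  ultimately show ?thesis using that[of "Inf S / 2" "(1 + Sup S) / 2"] * by auto
qed

lemma test_fun_ndiff: "test_fun f \<Longrightarrow> ndiff n f"
  using all_ndiff_iff[of f] by (auto simp: test_fun_def)

lemma test_fun_bump: "0 < a \<Longrightarrow> b < 1 \<Longrightarrow> test_fun (bump a b n)"
proof (rule test_fun_ndiffI[of _ a b])
  show "ndiff k (bump a b n)" for k
    unfolding bump_def[abs_def] by (intro ndiff_mult ndiff_affine[where f="flat 1"] ndiff_flat)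
qed (auto simp: bump_nonzero intro: less_imp_le)

lemma test_fun_has_deriv:
  assumes "test_fun f"
  shows "(f has_real_derivative deriv f x) (at x)"
proof -
  obtain f' where "\<And>x. (f has_real_derivative f' x) (at x)"
    using test_fun_ndiff[OF assms, of 1] by auto
  then show ?thesis using DERIV_imp_deriv by metis
qed

lemma test_fun_deriv:
  assumes "test_fun f"
  shows "test_fun (deriv f)"
proof -
  obtain a b where ab: "0 < a" "a < b" "b < 1" "\<And>x. f x \<noteq> 0 \<Longrightarrow> a \<le> x \<and> x \<le> b"
    using test_funE[OF assms] by blast
  have z: "deriv f x = 0" if "x \<notin> {a..b}" for x
  proof -
    have "((\<lambda>x. 0) has_real_derivative 0) (at x)" by simp
    moreover have "open (- {a..b})" by (intro open_Compl closed_atLeastAtMost)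
    moreover have "0 = f y" if "y \<in> - {a..b}" for y using that ab(4)[of y] by auto
    ultimately have "(f has_real_derivative 0) (at x)"
      using that by (rule_tac has_field_derivative_transform_within_open[where S="- {a..b}"]) auto
    then show ?thesis by (rule DERIV_imp_deriv)
  qed
  have "ndiff n (deriv f)" for n
    using test_fun_ndiff[OF assms, of "Suc n"] by (simp only: ndiff_Suc_iff_deriv)
  then show ?thesis
    by (rule test_fun_ndiffI[of _ a b]) (use ab z in auto)
qed

lemma test_fun_deriv_funpow: "test_fun f \<Longrightarrow> test_fun ((deriv ^^ k) f)"
  by (induction k) (auto intro: test_fun_deriv)

lemma test_fun_continuous: "test_fun f \<Longrightarrow> continuous_on S f"
  by (rule continuous_at_imp_continuous_on) (blast intro: DERIV_isCont test_fun_has_deriv)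

lemma test_fun_zero: "test_fun f \<Longrightarrow> x \<le> 0 \<or> 1 \<le> x \<Longrightarrow> f x = 0"
  by (erule test_funE) force

lemma test_fun_bounded:
  assumes "test_fun f"
  obtains C where "C > 0" "\<And>x. \<bar>f x\<bar> \<le> C"
proof -
  have "bounded (f ` {0..1})"
    using assms by (intro compact_imp_bounded compact_continuous_image test_fun_continuous) auto
  then obtain C where C: "C > 0" "\<And>x. x \<in> {0..1} \<Longrightarrow> \<bar>f x\<bar> \<le> C"
    by (force simp: bounded_pos)
  then have "\<bar>f x\<bar> \<le> C" for x
    using test_fun_zero[OF assms, of x] by (cases "x \<in> {0..1}") force+
  with C show ?thesis using that by blast
qed

lemma test_fun_measurable: "test_fun f \<Longrightarrow> f \<in> borel_measurable borel"
  by (intro borel_measurable_continuous_onI test_fun_continuous)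

lemma test_fun_diff_scale:
  assumes f: "test_fun f" and g: "test_fun g"
  shows "test_fun (\<lambda>x. f x - c * g x)"
proof -
  obtain a b where ab: "0 < a" "a < b" "b < 1" "\<And>x. f x \<noteq> 0 \<Longrightarrow> a \<le> x \<and> x \<le> b"
    using test_funE[OF f] by blast
  obtain a' b' where ab': "0 < a'" "a' < b'" "b' < 1" "\<And>x. g x \<noteq> 0 \<Longrightarrow> a' \<le> x \<and> x \<le> b'"
    using test_funE[OF g] by blast
  have "ndiff n (\<lambda>x. f x + (- c) * g x)" for n
    by (intro ndiff_add ndiff_mult ndiff_const test_fun_ndiff f g)
  then have n: "ndiff n (\<lambda>x. f x - c * g x)" for n by simp
  have "f x \<noteq> 0 \<or> g x \<noteq> 0" if "f x - c * g x \<noteq> 0" for x using that by auto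
  then show ?thesis
    by (intro test_fun_ndiffI[of _ "min a a'" "max b b'"] n)
      (use ab ab' in \<open>auto simp: min_le_iff_disj le_max_iff_disj\<close>)
qed

text \<open>The primitive vanishing at 0 is constant on either side of the support of \<open>f\<close>, and the zero
  mean of \<open>f\<close> makes both constants zero.\<close>

lemma test_fun_primitive:
  assumes f: "test_fun f" and int: "integral {0..1} f = 0"
  obtains g where "test_fun g" "deriv g = f"
proof -
  obtain a b where ab: "0 < a" "a < b" "b < 1" "\<And>x. f x \<noteq> 0 \<Longrightarrow> a \<le> x \<and> x \<le> b"
    using test_funE[OF f] by blast
  define g where "g x = (LBINT y=0..x. f y)" for x :: real
  have g': "(g has_real_derivative f x) (at x)" for x
  proof -
    have "(g has_vector_derivative f x) (at x within {min 0 x - 1..max 0 x + 1})"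
      unfolding g_def
      by (rule interval_integral_FTC2[of "min 0 x - 1" 0 "max 0 x + 1" f x, unfolded zero_ereal_def[symmetric]])
        (auto intro: test_fun_continuous f)
    moreover have "at x within {min 0 x - 1..max 0 x + 1} = at x"
      by (rule at_within_interior) auto
    ultimately show ?thesis by (simp add: has_real_derivative_iff_has_vector_derivative)
  qed
  have const: "g x = g y" if "convex S" "x \<in> S" "y \<in> S" "\<And>z. z \<in> S \<Longrightarrow> f z = 0" for S x y
    using has_field_derivative_zero_constant[of S g] that g'
    by (metis has_field_derivative_at_within)
  have "g x = g 0" if "x < a" for x
    by (rule const[of "{..<a}"]) (use that ab in force)+
  moreover have "g x = g 1" if "x > b" for x
    by (rule const[of "{b<..}"]) (use that ab in force)+
  moreover have "g 0 = 0" by (simp add: g_def zero_ereal_def[symmetric])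
  moreover have "g 1 = 0"
    using int interval_integral_eq_integral[of 0 1 f, unfolded zero_ereal_def[symmetric]]
      borel_integrable_atLeastAtMost'[of 0 1 f] test_fun_continuous[OF f]
    by (simp add: g_def zero_ereal_def[symmetric])
  ultimately have z: "g x \<noteq> 0 \<Longrightarrow> a \<le> x \<and> x \<le> b" for x
    by (metis linorder_not_less)
  have d: "deriv g = f" using g' by (auto intro: DERIV_imp_deriv)
  have "ndiff (Suc n) g" for n using test_fun_ndiff[OF f] g' by auto
  then have "ndiff n g" for n by (rule ndiff_SucD)
  then have "test_fun g" by (rule test_fun_ndiffI[of _ a b]) (use ab z in auto)
  with d show ?thesis using that by blast
qed


section \<open>Integration on the unit interval\<close>

lemma finite_measure_I01: "finite_measure I01"
  by (intro finite_measure_lebesgue_on) auto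

lemma measure_I01: "measure I01 {0<..<1} = 1"
  by (simp add: measure_restrict_space)

lemma borel_measurable_I01: "h \<in> borel_measurable borel \<Longrightarrow> h \<in> borel_measurable I01"
  by (intro measurable_restrict_space1 measurable_completion) simp

lemma continuous_measurable_I01:
  "continuous_on {0..1} h \<Longrightarrow> h \<in> borel_measurable I01"
  by (rule continuous_imp_measurable_on_sets_lebesgue) (auto elim: continuous_on_subset)

lemma AE_I01I: "(\<And>x. 0 < x \<Longrightarrow> x < 1 \<Longrightarrow> P x) \<Longrightarrow> AE x in I01. P x"
  by (rule AE_I2) auto

lemma integrable_bounded_scaleR:
  fixes u :: "real \<Rightarrow> 'b::{banach, second_countable_topology}"
  assumes u: "integrable M u" and h: "h \<in> borel_measurable M"
    and C: "\<And>x. x \<in> space M \<Longrightarrow> \<bar>h x\<bar> \<le> C"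
  shows "integrable M (\<lambda>x. h x *\<^sub>R u x)"
proof (rule Bochner_Integration.integrable_bound)
  show "integrable M (\<lambda>x. C * norm (u x))" using u by auto
  show "(\<lambda>x. h x *\<^sub>R u x) \<in> borel_measurable M"
    using u h by measurable
  have "norm (h x *\<^sub>R u x) \<le> norm (C * norm (u x))" if "x \<in> space M" for x
    using C[OF that] by (auto simp: abs_mult intro!: mult_right_mono)
  then show "AE x in M. norm (h x *\<^sub>R u x) \<le> norm (C * norm (u x))"
    by (intro AE_I2)
qed

lemma integrable_test_fun_scaleR:
  fixes u :: "real \<Rightarrow> 'b::{banach, second_countable_topology}"
  assumes "integrable I01 u" "test_fun f"
  shows "integrable I01 (\<lambda>x. f x *\<^sub>R u x)"
  using test_fun_bounded[OF assms(2)]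
  by (metis integrable_bounded_scaleR[OF assms(1)] borel_measurable_I01 test_fun_measurable assms(2))

lemma integrable_continuous_I01:
  fixes u :: "real \<Rightarrow> 'b::{banach, second_countable_topology}"
  assumes "continuous_on {0..1} u"
  shows "integrable I01 u"
proof -
  have "bounded (u ` {0..1})"
    using assms by (intro compact_imp_bounded compact_continuous_image) auto
  then obtain C where C: "\<And>x. x \<in> {0..1} \<Longrightarrow> norm (u x) \<le> C"
    by (force simp: bounded_iff)
  show ?thesis
    by (rule finite_measure.integrable_const_bound[OF finite_measure_I01, of _ C])
      (use C assms in \<open>auto intro!: AE_I01I continuous_measurable_I01\<close>)
qed

lemma LINT_I01_eq_integral:
  fixes f :: "real \<Rightarrow> 'b::euclidean_space"
  assumes "integrable I01 f"
  shows "(LINT x|I01. f x) = integral {0..1} f"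
  using lebesgue_integral_eq_integral[OF assms] integral_open_interval_real[of 0 1 f] by auto

section \<open>The fundamental lemma of the calculus of variations\<close>

text \<open>The sets over which \<open>f\<close> integrates to zero form a Dynkin system containing the open
  intervals, hence contain all Borel sets, in particular the sets on which a Borel version of
  \<open>f\<close> is positive or negative.\<close>

lemma AE_zero_if_interval_integrals_zero:
  fixes f :: "real \<Rightarrow> real"
  assumes f: "integrable lebesgue f"
    and ivl: "\<And>a b. (LINT x:{a<..<b}|lebesgue. f x) = 0"
    and total: "(LINT x|lebesgue. f x) = 0"
  shows "AE x in lebesgue. f x = 0"
proof -
  have fA: "set_integrable lebesgue A f" if "A \<in> sets lebesgue" for A
    using f that unfolding set_integrable_def by (intro integrable_mult_indicator)
  have Borel: "(LINT x:A|lebesgue. f x) = 0" if "A \<in> sets borel" for A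
  proof -
    let ?G = "range (\<lambda>(a::real, b). {a<..<b})"
    have sets: "sets borel = sigma_sets UNIV ?G"
      by (subst borel_eq_box) (simp add: box_real split_def)
    have "Int_stable ?G"
    proof (rule Int_stableI)
      fix A B assume "A \<in> ?G" "B \<in> ?G"
      then obtain a b c d where "A = {a<..<b}" "B = {c<..<d}" by auto
      then have "A \<inter> B = {max a c<..<min b d}" by auto
      then show "A \<inter> B \<in> ?G" by auto
    qed
    moreover have "?G \<subseteq> Pow UNIV" by simp
    moreover have "A \<in> sigma_sets UNIV ?G" using that sets by simp
    ultimately show ?thesis
    proof (induction rule: sigma_sets_induct_disjoint)
      case (basic A) then show ?case using ivl by auto
    next
      case (compl A)
      then have "A \<in> sets lebesgue" using sets by auto
      then have "(LINT x:A \<union> (UNIV - A)|lebesgue. f x)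
          = (LINT x:A|lebesgue. f x) + (LINT x:UNIV - A|lebesgue. f x)"
        by (intro set_integral_Un fA) auto
      with compl total show ?case by (simp add: set_lebesgue_integral_def)
    next
      case (union A)
      then have "A i \<in> sets borel" for i unfolding sets by auto
      then have A: "A i \<in> sets lebesgue" for i by simp
      then have "(LINT x:(\<Union>i. A i)|lebesgue. f x) = (\<Sum>i. LINT x:A i|lebesgue. f x)"
        using union by (intro lebesgue_integral_countable_add fA)
          (auto simp: disjoint_family_on_def)
      with union show ?case by simp
    qed (auto simp: set_lebesgue_integral_def)
  qed
  obtain g where g: "g \<in> borel_measurable lborel" "AE x in lborel. f x = g x"
    using completion_ex_borel_measurable_real[of f lborel] f by auto
  then have g2: "AE x in lebesgue. f x = g x" by (simp add: AE_completion)
  have "AE x in lebesgue. indicator {x. g x > 0} x * f x = 0"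
  proof (subst integral_nonneg_eq_0_iff_AE[symmetric])
    have m: "{x. g x > 0} \<in> sets borel" using g(1) by auto
    show "integrable lebesgue (\<lambda>x. indicator {x. g x > 0} x * f x)"
      using fA[of "{x. g x > 0}"] m by (auto simp: set_integrable_def)
    show "AE x in lebesgue. 0 \<le> indicator {x. g x > 0} x * f x"
      using g2 by eventually_elim (auto simp: indicator_def)
    show "(LINT x|lebesgue. indicator {x. g x > 0} x * f x) = 0"
      using Borel[OF m] by (simp add: set_lebesgue_integral_def)
  qed
  moreover have "AE x in lebesgue. - (indicator {x. g x < 0} x * f x) = 0"
  proof (subst integral_nonneg_eq_0_iff_AE[symmetric])
    have m: "{x. g x < 0} \<in> sets borel" using g(1) by auto
    show "integrable lebesgue (\<lambda>x. - (indicator {x. g x < 0} x * f x))"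
      using fA[of "{x. g x < 0}"] m by (auto simp: set_integrable_def)
    show "AE x in lebesgue. 0 \<le> - (indicator {x. g x < 0} x * f x)"
      using g2 by eventually_elim (auto simp: indicator_def)
    show "(LINT x|lebesgue. - (indicator {x. g x < 0} x * f x)) = 0"
      using Borel[OF m] by (simp add: set_lebesgue_integral_def)
  qed
  ultimately show ?thesis
    using g2 by eventually_elim (auto simp: indicator_def split: if_splits)
qed

text \<open>Bump functions converge boundedly to indicators of intervals, so \<open>r\<close> integrates to zero
  over all intervals.\<close>

lemma fundamental_lemma_real:
  fixes r :: "real \<Rightarrow> real"
  assumes r: "integrable I01 r" and 0: "\<And>f. test_fun f \<Longrightarrow> (LINT x|I01. f x * r x) = 0"
  shows "AE x in I01. r x = 0"
proof -
  \<comment> \<open>Bumps are test functions only on intervals compactly contained in the unit interval; general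
    intervals are exhausted by such intervals below.\<close>
  have inner: "(LINT x|I01. indicator {a<..<b} x * r x) = 0" if "0 < a" "b < 1" for a b
  proof -
    have "(\<lambda>n. LINT x|I01. bump a b n x * r x) \<longlonglongrightarrow> (LINT x|I01. indicator {a<..<b} x * r x)"
    proof (rule integral_dominated_convergence[where w="\<lambda>x. \<bar>r x\<bar>"])
      show "integrable I01 (\<lambda>x. \<bar>r x\<bar>)" using r by auto
      show "AE x in I01. (\<lambda>n. bump a b n x * r x) \<longlonglongrightarrow> indicator {a<..<b} x * r x"
        by (intro AE_I2 tendsto_intros bump_tendsto_indicator)
      show "AE x in I01. norm (bump a b n x * r x) \<le> \<bar>r x\<bar>" for n
        using bump_bounds[of a b n] by (auto intro!: AE_I2 mult_left_le_one_le simp: abs_mult)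
      show "(\<lambda>x. bump a b n x * r x) \<in> borel_measurable I01" for n
        using integrable_test_fun_scaleR[OF r test_fun_bump[OF that, of n]] by auto
      show "(\<lambda>x. indicator {a<..<b} x * r x) \<in> borel_measurable I01"
        by (intro borel_measurable_times borel_measurable_integrable[OF r] borel_measurable_I01) auto
    qed
    then show ?thesis using 0[OF test_fun_bump[OF that]] by (simp add: LIMSEQ_const_iff)
  qed
  have ivl: "(LINT x|I01. indicator {a<..<b} x * r x) = 0" for a b
  proof -
    let ?a = "\<lambda>n. max a (inverse (real (Suc n)) / 2)" and ?b = "\<lambda>n. min b (1 - inverse (real (Suc n)) / 2)"
    have "(\<lambda>n. LINT x|I01. indicator {?a n<..<?b n} x * r x) \<longlonglongrightarrow> (LINT x|I01. indicator {a<..<b} x * r x)"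
    proof (rule integral_dominated_convergence[where w="\<lambda>x. \<bar>r x\<bar>"])
      show "integrable I01 (\<lambda>x. \<bar>r x\<bar>)" using r by auto
      show "AE x in I01. (\<lambda>n. indicator {?a n<..<?b n} x * r x) \<longlonglongrightarrow> indicator {a<..<b} x * r x"
      proof (intro AE_I01I tendsto_eventually)
        fix x :: real assume x: "0 < x" "x < 1"
        have lim: "(\<lambda>n. inverse (real (Suc n)) / 2) \<longlonglongrightarrow> 0"
          using tendsto_divide[OF LIMSEQ_inverse_real_of_nat tendsto_const[of 2]] by simp
        have "\<forall>\<^sub>F n in sequentially. inverse (real (Suc n)) / 2 < x"
          by (rule order_tendstoD(2)[OF lim x(1)])
        moreover have "\<forall>\<^sub>F n in sequentially. inverse (real (Suc n)) / 2 < 1 - x"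
          by (rule order_tendstoD(2)[OF lim]) (use x in simp)
        ultimately show "\<forall>\<^sub>F n in sequentially. indicator {?a n<..<?b n} x * r x = indicator {a<..<b} x * r x"
          by eventually_elim (auto simp: indicator_def)
      qed
      show "AE x in I01. norm (indicator {?a n<..<?b n} x * r x) \<le> \<bar>r x\<bar>" for n
        by (auto intro!: AE_I2 simp: indicator_def)
    qed (intro borel_measurable_times borel_measurable_integrable[OF r] borel_measurable_I01; simp)+
    moreover have "(LINT x|I01. indicator {?a n<..<?b n} x * r x) = 0" for n
      by (rule inner) (auto simp: less_max_iff_disj min_less_iff_disj)
    ultimately show ?thesis by (simp add: LIMSEQ_const_iff)
  qed
  let ?f = "\<lambda>x. indicator {0<..<1} x * r x"
  have "AE x in lebesgue. ?f x = 0"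
  proof (rule AE_zero_if_interval_integrals_zero)
    show "integrable lebesgue ?f"
      using r by (subst (asm) integrable_restrict_space) (auto simp: set_integrable_def)
    show i: "(LINT x:{a<..<b}|lebesgue. ?f x) = 0" for a b
      using ivl[of a b]
      by (subst (asm) integral_restrict_space)
        (auto simp: set_lebesgue_integral_def mult.left_commute)
    have "(LINT x|lebesgue. ?f x) = (LINT x:{0<..<1}|lebesgue. ?f x)"
      unfolding set_lebesgue_integral_def by (rule Bochner_Integration.integral_cong) (auto simp: indicator_def)
    then show "(LINT x|lebesgue. ?f x) = 0" using i by simp
  qed
  then have "AE x in lebesgue. x \<in> {0<..<1} \<longrightarrow> r x = 0"
    by eventually_elim auto
  then show ?thesis by (subst AE_restrict_space_iff) auto
qed

lemma fundamental_lemma: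
  fixes v :: "real \<Rightarrow> complex"
  assumes v: "integrable I01 v" and 0: "\<And>f. test_fun f \<Longrightarrow> (LINT x|I01. f x *\<^sub>R v x) = 0"
  shows "AE x in I01. v x = 0"
proof -
  have "AE x in I01. Re (v x) = 0"
  proof (rule fundamental_lemma_real)
    fix f assume f: "test_fun f"
    from integral_Re[OF integrable_test_fun_scaleR[OF v f]] 0[OF f]
    show "(LINT x|I01. f x * Re (v x)) = 0" by simp
  qed (use v in auto)
  moreover have "AE x in I01. Im (v x) = 0"
  proof (rule fundamental_lemma_real)
    fix f assume f: "test_fun f"
    from integral_Im[OF integrable_test_fun_scaleR[OF v f]] 0[OF f]
    show "(LINT x|I01. f x * Im (v x)) = 0" by simp
  qed (use v in auto)
  ultimately show ?thesis by eventually_elim (auto simp: complex_eq_iff)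
qed

text \<open>The set where \<open>g\<close> and \<open>h\<close> differ inside the open interval is open and null, hence empty; the
  end points follow by continuity. Consequently boundary values do not depend on the choice of
  the continuous representative.\<close>

lemma continuous_AE_eq_imp_eq:
  fixes g h :: "real \<Rightarrow> complex"
  assumes "continuous_on {0..1} g" "continuous_on {0..1} h" "AE x in I01. g x = h x" "x \<in> {0..1}"
  shows "g x = h x"
proof -
  let ?N = "{x \<in> {0<..<1}. g x - h x \<noteq> 0}"
  have "open ?N"
  proof -
    have "continuous_on {0<..<1} (\<lambda>x. g x - h x)"
      using assms by (intro continuous_on_diff) (auto elim: continuous_on_subset)
    then have "open ({0<..<1} \<inter> (\<lambda>x. g x - h x) -` (- {0}))"
      by (intro continuous_open_preimage) auto
    moreover have "{0<..<1} \<inter> (\<lambda>x. g x - h x) -` (- {0}) = ?N" by auto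
    ultimately show ?thesis by simp
  qed
  moreover have "negligible ?N"
  proof -
    have "AE x in lebesgue. x \<in> {0<..<1} \<longrightarrow> g x = h x"
      using assms(3) by (subst (asm) AE_restrict_space_iff) auto
    then obtain N where "N \<in> null_sets lebesgue" "\<forall>x\<in>{0<..<1} - N. g x = h x"
      by (auto elim!: AE_E3)
    then show ?thesis
      by (intro negligible_subset[of N ?N]) (auto simp: negligible_iff_null_sets)
  qed
  ultimately have "?N = {}" using open_not_negligible by blast
  then have eq: "g y - h y = 0" if "y \<in> {0<..<1}" for y using that by auto
  have "g x - h x = 0"
    by (rule continuous_constant_on_closure[of "{0<..<1}" "\<lambda>x. g x - h x" 0 x])
      (use assms eq in \<open>auto intro!: continuous_on_diff\<close>)
  then show ?thesis by simp
qed


section \<open>Weak derivatives and primitives\<close>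

text \<open>The integral of \<open>v\<close> from 0 to \<open>x\<close>, written over the whole unit interval so that Fubini's
  theorem and dominated convergence apply directly.\<close>

definition prim :: "(real \<Rightarrow> complex) \<Rightarrow> real \<Rightarrow> complex" where
  "prim v x = (LINT t|I01. indicator {..<x} t *\<^sub>R v t)"

lemma integrable_prim_integrand:
  fixes v :: "real \<Rightarrow> 'b::{banach, second_countable_topology}"
  assumes "integrable I01 v" "A \<in> sets borel"
  shows "integrable I01 (\<lambda>t. indicator A t *\<^sub>R v t)"
  by (rule integrable_bounded_scaleR[OF assms(1), of _ 1])
    (use assms in \<open>auto intro!: borel_measurable_I01 simp: indicator_def\<close>)

lemma prim_0: "prim v 0 = 0"
  unfolding prim_def by (subst Bochner_Integration.integral_cong[OF refl, of _ _ "\<lambda>_. 0"]) auto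

lemma norm_prim_le: "norm (prim v x) \<le> (LINT t|I01. indicator {..<x} t * norm (v t))"
proof -
  have "norm (prim v x) \<le> (LINT t|I01. norm (indicator {..<x} t *\<^sub>R v t))"
    unfolding prim_def by (rule integral_norm_bound)
  then show ?thesis by simp
qed

lemma LINT_lessThan_eq_integral:
  fixes v :: "real \<Rightarrow> 'b::euclidean_space"
  assumes v: "integrable I01 v" and x: "x \<in> {0..1}"
  shows "(LINT t|I01. indicator {..<x} t *\<^sub>R v t) = integral {0..x} v"
proof -
  have "(LINT t|I01. indicator {..<x} t *\<^sub>R v t) = integral {0..1} (\<lambda>t. indicator {..<x} t *\<^sub>R v t)"
    by (rule LINT_I01_eq_integral) (intro integrable_prim_integrand v, simp)
  also have "\<dots> = integral {0..1} (\<lambda>t. if t \<in> {0..<x} then v t else 0)"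
    by (rule Henstock_Kurzweil_Integration.integral_cong) (auto simp: indicator_def)
  also have "\<dots> = integral ({0..<x} \<inter> {0..1}) v"
    using integral_restrict_Int[of "{0..1}" "{0..<x}" v] by simp
  also have "{0..<x} \<inter> {0..1} = {0..<x}" using x by auto
  also have "integral {0..<x} v = integral {0..x} v"
  proof (rule integral_subset_negligible)
    have "{0..x} - {0..<x} = {x}" using x by auto
    then show "negligible ({0..x} - {0..<x})" by simp
  qed auto
  finally show ?thesis .
qed

lemma continuous_on_prim:
  assumes v: "integrable I01 v"
  shows "continuous_on S (prim v)"
proof (rule continuous_on_sequentiallyI)
  fix X :: "nat \<Rightarrow> real" and x assume X: "X \<longlonglongrightarrow> x"
  show "(\<lambda>n. prim v (X n)) \<longlonglongrightarrow> prim v x"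
    unfolding prim_def
  proof (rule integral_dominated_convergence[where w="\<lambda>t. norm (v t)"])
    show "AE t in I01. (\<lambda>n. indicator {..<X n} t *\<^sub>R v t) \<longlonglongrightarrow> indicator {..<x} t *\<^sub>R v t"
    proof -
      have "AE t in lebesgue. t \<noteq> x"
        using AE_lborel_singleton[of x] by (rule AE_completion)
      then have "AE t in I01. t \<noteq> x" by (subst AE_restrict_space_iff) auto
      then show ?thesis
      proof eventually_elim
        case (elim t)
        have "\<forall>\<^sub>F n in sequentially. (indicator {..<X n} t :: real) = indicator {..<x} t"
        proof (cases "t < x")
          case True
          then show ?thesis using order_tendstoD(1)[OF X True] by (auto elim: eventually_mono)
        next
          case False
          then have "x < t" using elim by simp
          from order_tendstoD(2)[OF X this] False show ?thesis
            by (auto elim: eventually_mono simp: indicator_def)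
        qed
        then show ?case by (intro tendsto_intros tendsto_eventually)
      qed
    qed
    show "AE t in I01. norm (indicator {..<X n} t *\<^sub>R v t) \<le> norm (v t)" for n
      by (auto simp: indicator_def)
  qed (use v integrable_prim_integrand[OF v] in auto)
qed

text \<open>Integration by parts when one factor is only absolutely continuous: exchange the order
  of integration in the double integral of \<open>f'(x) v(t)\<close> over \<open>t < x\<close> and integrate \<open>f'\<close> from
  \<open>t\<close> to 1.\<close>

lemma integral_prim_deriv_test_fun:
  assumes v: "integrable I01 v" and f: "test_fun f"
  shows "(LINT x|I01. deriv f x *\<^sub>R prim v x) = - (LINT x|I01. f x *\<^sub>R v x)"
proof -
  interpret I: finite_measure I01 by (rule finite_measure_I01)
  interpret P: pair_sigma_finite I01 I01 by unfold_locales
  obtain C where C: "C > 0" "\<And>x. \<bar>deriv f x\<bar> \<le> C"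
    using test_fun_bounded[OF test_fun_deriv[OF f]] by blast
  define F where "F = (\<lambda>x t. (deriv f x * indicator {..<x} t) *\<^sub>R v t)"
  have [measurable]: "deriv f \<in> borel_measurable I01"
    by (intro borel_measurable_I01 test_fun_measurable test_fun_deriv f)
  have [measurable]: "v \<in> borel_measurable I01" using v by auto
  have [measurable]: "(\<lambda>x. x) \<in> borel_measurable I01" by (rule borel_measurable_I01) simp
  have ind: "indicator {..<x} t = (if t < x then 1 else 0 :: real)" for x t :: real by auto
  have Fm: "case_prod F \<in> borel_measurable (I01 \<Otimes>\<^sub>M I01)"
    unfolding F_def ind by measurable
  have Fint: "integrable I01 (F x)" for x
    unfolding F_def by (rule integrable_bounded_scaleR[OF v, of _ C])
      (use C(2)[of x] C(1) in \<open>auto intro!: borel_measurable_I01 simp: indicator_def\<close>)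
  have bound: "(LINT t|I01. norm (F x t)) \<le> C * (LINT t|I01. norm (v t))" for x
  proof -
    have "(LINT t|I01. norm (F x t)) \<le> (LINT t|I01. C * norm (v t))"
    proof (rule integral_mono)
      show "norm (F x t) \<le> C * norm (v t)" for t
        using C(2)[of x] C(1) by (auto simp: F_def abs_mult indicator_def intro!: mult_right_mono)
    qed (use Fint[of x] v in auto)
    then show ?thesis by simp
  qed
  have "integrable (I01 \<Otimes>\<^sub>M I01) (case_prod F)"
  proof (rule P.Fubini_integrable[OF Fm])
    have "norm (LINT t|I01. norm (F x t)) \<le> C * (LINT t|I01. norm (v t))" for x
      using bound[of x] by simp
    then show "integrable I01 (\<lambda>x. LINT y|I01. norm (case (x, y) of (x, y) \<Rightarrow> F x y))"
      using Fm by (intro I.integrable_const_bound[where B="C * (LINT t|I01. norm (v t))"] AE_I2) auto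
    show "AE x in I01. integrable I01 (\<lambda>y. case (x, y) of (x, y) \<Rightarrow> F x y)"
      using Fint by auto
  qed
  then have "(LINT t|I01. LINT x|I01. F x t) = (LINT x|I01. LINT t|I01. F x t)"
    by (rule P.Fubini_integral)
  also have "(LINT x|I01. LINT t|I01. F x t) = (LINT x|I01. deriv f x *\<^sub>R prim v x)"
    by (simp add: F_def prim_def flip: scaleR_scaleR)
  also have "(LINT t|I01. LINT x|I01. F x t) = (LINT t|I01. - (f t *\<^sub>R v t))"
  proof (rule Bochner_Integration.integral_cong[OF refl])
    fix t assume "t \<in> space I01"
    then have t: "0 < t" "t < 1" by auto
    have i: "integrable I01 (\<lambda>x. deriv f x * indicator {t<..} x)"
      using integrable_test_fun_scaleR[OF integrable_prim_integrand[of "\<lambda>_. 1::real" "{t<..}"]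
          test_fun_deriv[OF f]] by (simp add: integrable_continuous_I01)
    have "(LINT x|I01. deriv f x * indicator {t<..} x) = integral {0..1} (\<lambda>x. deriv f x * indicator {t<..} x)"
      by (rule LINT_I01_eq_integral[OF i])
    also have "\<dots> = integral {t<..1} (deriv f)"
    proof -
      have "{t<..1} \<inter> {0..1} = {t<..1}" using t by auto
      with integral_restrict_Int[of "{0..1}" "{t<..1}" "deriv f"]
      have "integral {t<..1} (deriv f) = integral {0..1} (\<lambda>x. if x \<in> {t<..1} then deriv f x else 0)"
        by simp
      also have "\<dots> = integral {0..1} (\<lambda>x. deriv f x * indicator {t<..} x)"
        by (rule Henstock_Kurzweil_Integration.integral_cong) (auto simp: indicator_def)
      finally show ?thesis by simp
    qed
    also have "\<dots> = integral {t..1} (deriv f)"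
    proof (rule integral_subset_negligible)
      have "{t..1} - {t<..1} = {t}" using t by auto
      then show "negligible ({t..1} - {t<..1})" by simp
    qed auto
    also have "\<dots> = f 1 - f t"
      using fundamental_theorem_of_calculus[of t 1 f "deriv f"] t test_fun_has_deriv[OF f]
      by (intro integral_unique)
        (auto simp: has_real_derivative_iff_has_vector_derivative[symmetric]
          intro: has_field_derivative_at_within)
    finally have "(LINT x|I01. deriv f x * indicator {t<..} x) = - f t"
      using test_fun_zero[OF f, of 1] by simp
    moreover have "F x t = (deriv f x * indicator {t<..} x) *\<^sub>R v t" for x
      by (auto simp: F_def indicator_def)
    ultimately show "(LINT x|I01. F x t) = - (f t *\<^sub>R v t)"
      using i by simp
  qed
  finally show ?thesis by simp
qed

lemma weak_deriv_prim:
  assumes v: "integrable I01 v" and m: "u \<in> borel_measurable I01"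
    and u: "AE x in I01. u x = c + prim v x"
  shows "is_weak_deriv 1 u v"
  unfolding is_weak_deriv_def
proof (intro allI impI)
  fix f assume f: "test_fun f"
  have df: "test_fun (deriv f)" by (rule test_fun_deriv[OF f])
  have p: "integrable I01 (prim v)" by (intro integrable_continuous_I01 continuous_on_prim v)
  have int_c: "integrable I01 (\<lambda>x. c)" by (intro integrable_continuous_I01 continuous_intros)
  have "(LINT x|I01. deriv f x *\<^sub>R u x) = (LINT x|I01. deriv f x *\<^sub>R c + deriv f x *\<^sub>R prim v x)"
  proof (rule integral_cong_AE)
    show "AE x in I01. deriv f x *\<^sub>R u x = deriv f x *\<^sub>R c + deriv f x *\<^sub>R prim v x"
      using u by eventually_elim (simp add: scaleR_add_right)
    show "(\<lambda>x. deriv f x *\<^sub>R u x) \<in> borel_measurable I01"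
      by (intro borel_measurable_scaleR m borel_measurable_I01 test_fun_measurable df)
    show "(\<lambda>x. deriv f x *\<^sub>R c + deriv f x *\<^sub>R prim v x) \<in> borel_measurable I01"
      using integrable_test_fun_scaleR[OF p df] integrable_test_fun_scaleR[OF int_c df] by auto
  qed
  also have "\<dots> = (LINT x|I01. deriv f x *\<^sub>R c) + (LINT x|I01. deriv f x *\<^sub>R prim v x)"
    by (intro Bochner_Integration.integral_add integrable_test_fun_scaleR df p int_c)
  also have "(LINT x|I01. deriv f x *\<^sub>R c) = 0"
  proof -
    have i: "integrable I01 (deriv f)" 
      by (intro integrable_continuous_I01 test_fun_continuous df)
    have "(LINT x|I01. deriv f x) = f 1 - f 0"
      unfolding LINT_I01_eq_integral[OF i]
      using fundamental_theorem_of_calculus[of 0 1 f "deriv f"] test_fun_has_deriv[OF f]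
      by (intro integral_unique)
        (auto simp: has_real_derivative_iff_has_vector_derivative[symmetric]
          intro: has_field_derivative_at_within)
    then show ?thesis using i test_fun_zero[OF f, of 1] test_fun_zero[OF f, of 0] by simp
  qed
  also note integral_prim_deriv_test_fun[OF v f]
  finally show "(LINT x|I01. (deriv ^^ 1) f x *\<^sub>R u x) = (- 1) ^ 1 * (LINT x|I01. f x *\<^sub>R v x)"
    by simp
qed

text \<open>The difference \<open>h\<close> of \<open>u\<close> and the primitive of \<open>v\<close> is orthogonal to all derivatives of test
  functions. A test function \<open>f\<close> becomes such a derivative after subtracting a multiple of one
  fixed bump \<open>g\<close>, so testing \<open>h\<close> with \<open>f\<close> only sees the integral of \<open>f\<close>, as for a constant.\<close>

lemma du_Bois_Reymond:
  assumes u: "integrable I01 u" and v: "integrable I01 v" and w: "is_weak_deriv 1 u v"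
  shows "\<exists>c. AE x in I01. u x = c + prim v x"
proof -
  have p: "integrable I01 (prim v)" by (intro integrable_continuous_I01 continuous_on_prim v)
  define h where "h = (\<lambda>x. u x - prim v x)"
  have h: "integrable I01 h" unfolding h_def using u p by simp
  have h0: "(LINT x|I01. deriv f x *\<^sub>R h x) = 0" if f: "test_fun f" for f
  proof -
    have "(LINT x|I01. deriv f x *\<^sub>R h x) = (LINT x|I01. deriv f x *\<^sub>R u x) - (LINT x|I01. deriv f x *\<^sub>R prim v x)"
      unfolding h_def scaleR_diff_right
      by (intro Bochner_Integration.integral_diff integrable_test_fun_scaleR test_fun_deriv f u p)
    with w f integral_prim_deriv_test_fun[OF v f] show ?thesis by (simp add: is_weak_deriv_def)
  qed
  define g where "g = bump (1/4) (3/4) 0"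
  have g: "test_fun g" by (auto simp: g_def intro: test_fun_bump)
  define Z where "Z = integral {0..1} g"
  have "Z \<noteq> 0"
  proof
    assume "Z = 0"
    then have "g (1/2) = 0"
      using integral_eq_0_iff[of 0 1 g] test_fun_continuous[OF g]
      by (auto simp: Z_def g_def bump_bounds)
    then show False using bump_nonzero[of "1/4" "3/4" 0 "1/2"] by (simp add: g_def)
  qed
  define c where "c = (LINT x|I01. g x *\<^sub>R h x) / of_real Z"
  have "AE x in I01. h x - c = 0"
  proof (rule fundamental_lemma)
    show "integrable I01 (\<lambda>x. h x - c)"
      by (intro Bochner_Integration.integrable_diff h integrable_continuous_I01[of "\<lambda>_. c"]) auto
    fix f assume f: "test_fun f"
    let ?s = "integral {0..1} f"
    have iF: "integrable I01 f" and iG: "integrable I01 g"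
      by (intro integrable_continuous_I01 test_fun_continuous f g)+
    have t: "test_fun (\<lambda>x. f x - ?s / Z * g x)" by (rule test_fun_diff_scale[OF f g])
    have "integral {0..1} (\<lambda>x. f x - ?s / Z * g x) = ?s - ?s / Z * Z"
      using test_fun_continuous[OF f] test_fun_continuous[OF g]
      by (subst Henstock_Kurzweil_Integration.integral_diff)
        (simp_all add: Z_def integrable_continuous_real continuous_on_mult_left del: times_divide_eq_left)
    then have "integral {0..1} (\<lambda>x. f x - ?s / Z * g x) = 0" using \<open>Z \<noteq> 0\<close> by simp
    from test_fun_primitive[OF t this] obtain G where G: "test_fun G" "deriv G = (\<lambda>x. f x - ?s / Z * g x)"
      by blast
    have "0 = (LINT x|I01. f x *\<^sub>R h x - (?s / Z) *\<^sub>R (g x *\<^sub>R h x))"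
      using h0[OF G(1)] G(2) by (simp add: scaleR_diff_left)
    also have "\<dots> = (LINT x|I01. f x *\<^sub>R h x) - (?s / Z) *\<^sub>R (LINT x|I01. g x *\<^sub>R h x)"
      using integrable_test_fun_scaleR[OF h f] integrable_test_fun_scaleR[OF h g]
      by (subst Bochner_Integration.integral_diff) (simp_all del: scaleR_scaleR)
    also have "(?s / Z) *\<^sub>R (LINT x|I01. g x *\<^sub>R h x) = (LINT x|I01. f x) *\<^sub>R c"
      unfolding LINT_I01_eq_integral[OF iF] by (simp add: c_def scaleR_conv_of_real)
    also have "\<dots> = (LINT x|I01. f x *\<^sub>R c)"
      using iF by simp
    also have "(LINT x|I01. f x *\<^sub>R h x) - (LINT x|I01. f x *\<^sub>R c) = (LINT x|I01. f x *\<^sub>R (h x - c))"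
      using integrable_test_fun_scaleR[OF h f] iF
      by (subst Bochner_Integration.integral_diff[symmetric]) (auto simp: scaleR_diff_right)
    finally show "(LINT x|I01. f x *\<^sub>R (h x - c)) = 0" by simp
  qed
  then have "AE x in I01. u x = c + prim v x"
    by eventually_elim (auto simp: h_def algebra_simps)
  then show ?thesis by blast
qed

lemma cont_rep_eq:
  assumes g: "continuous_on {0..1} g" "AE x in I01. u x = g x" and x: "x \<in> {0..1}"
  shows "cont_rep u x = g x"
proof -
  have "\<exists>g. continuous_on {0..1} g \<and> (AE x in I01. g x = u x)"
    using g by (intro exI[of _ g]) (auto elim: eventually_mono)
  then have "continuous_on {0..1} (cont_rep u)" "AE x in I01. cont_rep u x = u x"
    unfolding cont_rep_def by (auto dest!: someI_ex)
  then show ?thesis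
    using g x by (intro continuous_AE_eq_imp_eq) (auto elim: AE_mp)
qed

lemma cont_rep_weak_deriv:
  assumes u: "integrable I01 u" and v: "integrable I01 v" and w: "is_weak_deriv 1 u v"
  shows "AE x in I01. u x = cont_rep u 0 + prim v x"
    and "x \<in> {0..1} \<Longrightarrow> cont_rep u x = cont_rep u 0 + prim v x"
proof -
  obtain c where c: "AE x in I01. u x = c + prim v x"
    using du_Bois_Reymond[OF assms] by blast
  have rep: "cont_rep u x = c + prim v x" if "x \<in> {0..1}" for x
    by (rule cont_rep_eq[OF _ c that]) (intro continuous_intros continuous_on_prim v)
  have "cont_rep u 0 = c" using rep[of 0] by (simp add: prim_0)
  with c rep show "AE x in I01. u x = cont_rep u 0 + prim v x"
    and "x \<in> {0..1} \<Longrightarrow> cont_rep u x = cont_rep u 0 + prim v x" by auto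
qed


section \<open>Estimates in the Lebesgue space\<close>

lemma L2_measurable: "u \<in> L2 \<Longrightarrow> u \<in> borel_measurable I01"
  by (simp add: L2_def)

lemma L2_norm_power2: "(L2_norm u)\<^sup>2 = (LINT x|I01. (cmod (u x))\<^sup>2)"
  by (simp add: L2_norm_def)

lemma L2_norm_nonneg: "0 \<le> L2_norm u"
  by (simp add: L2_norm_def)

lemma L2_dominated:
  assumes m: "u \<in> borel_measurable I01" and i: "integrable I01 g"
    and le: "AE x in I01. (cmod (u x))\<^sup>2 \<le> g x"
  shows "u \<in> L2" "(L2_norm u)\<^sup>2 \<le> (LINT x|I01. g x)"
proof -
  have "integrable I01 (\<lambda>x. (cmod (u x))\<^sup>2)"
  proof (rule Bochner_Integration.integrable_bound[OF i])
    show "(\<lambda>x. (cmod (u x))\<^sup>2) \<in> borel_measurable I01" using m by measurable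
    show "AE x in I01. norm ((cmod (u x))\<^sup>2) \<le> norm (g x)"
      using le by eventually_elim auto
  qed
  then show "u \<in> L2" "(L2_norm u)\<^sup>2 \<le> (LINT x|I01. g x)"
    using m i le by (auto simp: L2_def L2_norm_power2 intro: integral_mono_AE)
qed

lemma L2_integrable_power2: "u \<in> L2 \<Longrightarrow> integrable I01 (\<lambda>x. (cmod (u x))\<^sup>2)"
  by (simp add: L2_def)

lemma integrable_const_I01: "integrable I01 (\<lambda>x. c :: 'b::{banach, second_countable_topology})"
  by (intro integrable_continuous_I01 continuous_intros)

lemma L2_bounded:
  assumes "u \<in> borel_measurable I01" "AE x in I01. cmod (u x) \<le> C"
  shows "u \<in> L2" "(L2_norm u)\<^sup>2 \<le> C\<^sup>2"
proof -
  have "AE x in I01. (cmod (u x))\<^sup>2 \<le> C\<^sup>2"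
    using assms(2) by eventually_elim (auto intro: power_mono)
  from L2_dominated[OF assms(1) integrable_const_I01 this]
  show "u \<in> L2" "(L2_norm u)\<^sup>2 \<le> C\<^sup>2"
    by (simp_all add: measure_I01)
qed

lemma norm_add_power2_le: "(norm (x + y))\<^sup>2 \<le> 2 * (norm x)\<^sup>2 + 2 * (norm y)\<^sup>2"
  for x y :: "'a::real_normed_vector"
proof -
  have "(norm (x + y))\<^sup>2 \<le> (norm x + norm y)\<^sup>2"
    by (intro power_mono norm_triangle_ineq) auto
  also have "\<dots> \<le> 2 * (norm x)\<^sup>2 + 2 * (norm y)\<^sup>2"
    using sum_squares_bound[of "norm x" "norm y"] by (simp add: power2_sum)
  finally show ?thesis .
qed

lemma L2_add:
  assumes u: "u \<in> L2" and v: "v \<in> L2"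
  shows "(\<lambda>x. u x + v x) \<in> L2"
    and "(L2_norm (\<lambda>x. u x + v x))\<^sup>2 \<le> 2 * (L2_norm u)\<^sup>2 + 2 * (L2_norm v)\<^sup>2"
proof -
  have m: "(\<lambda>x. u x + v x) \<in> borel_measurable I01"
    using u v by (intro borel_measurable_add L2_measurable)
  have i: "integrable I01 (\<lambda>x. 2 * (cmod (u x))\<^sup>2 + 2 * (cmod (v x))\<^sup>2)"
    using L2_integrable_power2[OF u] L2_integrable_power2[OF v] by simp
  have "AE x in I01. (cmod (u x + v x))\<^sup>2 \<le> 2 * (cmod (u x))\<^sup>2 + 2 * (cmod (v x))\<^sup>2"
    by (intro AE_I2 norm_add_power2_le)
  from L2_dominated[OF m i this]
  show "(\<lambda>x. u x + v x) \<in> L2"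
    and "(L2_norm (\<lambda>x. u x + v x))\<^sup>2 \<le> 2 * (L2_norm u)\<^sup>2 + 2 * (L2_norm v)\<^sup>2"
    using L2_integrable_power2[OF u] L2_integrable_power2[OF v]
    by (simp_all add: L2_norm_power2)
qed

lemma L2_mult_bounded:
  assumes a: "a \<in> borel_measurable I01" "AE x in I01. cmod (a x) \<le> A" and u: "u \<in> L2"
  shows "(\<lambda>x. a x * u x) \<in> L2"
proof (rule L2_dominated)
  show "(\<lambda>x. a x * u x) \<in> borel_measurable I01"
    by (intro borel_measurable_times a(1) L2_measurable[OF u])
  show "integrable I01 (\<lambda>x. A\<^sup>2 * (cmod (u x))\<^sup>2)" using L2_integrable_power2[OF u] by simp
  show "AE x in I01. (cmod (a x * u x))\<^sup>2 \<le> A\<^sup>2 * (cmod (u x))\<^sup>2"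
    using a(2) by eventually_elim (auto simp: norm_mult power_mult_distrib intro!: mult_right_mono power_mono)
qed

lemma L2_cmult: "u \<in> L2 \<Longrightarrow> (\<lambda>x. c * u x) \<in> L2"
  by (rule L2_mult_bounded[of "\<lambda>_. c" "cmod c"]) auto

lemma L2_lincomb: "u \<in> L2 \<Longrightarrow> v \<in> L2 \<Longrightarrow> (\<lambda>x. u x + c * v x) \<in> L2"
  by (intro L2_add L2_cmult)

lemma L2_diff: "u \<in> L2 \<Longrightarrow> v \<in> L2 \<Longrightarrow> (\<lambda>x. u x - v x) \<in> L2"
  using L2_lincomb[of u v "- 1"] by simp

lemma L2_norm_cong_AE:
  assumes "u \<in> L2" "v \<in> L2" "AE x in I01. u x = v x"
  shows "L2_norm u = L2_norm v"
proof -
  have "(LINT x|I01. (cmod (u x))\<^sup>2) = (LINT x|I01. (cmod (v x))\<^sup>2)"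
    using assms L2_integrable_power2[of u] L2_integrable_power2[of v]
    by (intro integral_cong_AE) (auto elim: eventually_mono)
  then show ?thesis by (simp add: L2_norm_def)
qed

lemma L2_imp_integrable:
  assumes "u \<in> L2"
  shows "integrable I01 u"
proof (rule Bochner_Integration.integrable_bound)
  show "integrable I01 (\<lambda>x. 1 + (cmod (u x))\<^sup>2)"
    using L2_integrable_power2[OF assms] by (intro Bochner_Integration.integrable_add integrable_const_I01)
  have "t \<le> 1 + t\<^sup>2" for t :: real
    using sum_squares_bound[of t 1] by (simp add: power2_eq_square) (smt (verit) mult_nonneg_nonneg zero_le_square)
  then show "AE x in I01. norm (u x) \<le> norm (1 + (cmod (u x))\<^sup>2)"
    by (intro AE_I2) (simp add: abs_of_nonneg)
qed (use assms L2_measurable in auto)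

text \<open>The unit interval has measure 1, so this is the nonnegativity of the variance of \<open>|u|\<close>.\<close>

lemma L1_le_L2_norm:
  assumes u: "u \<in> L2"
  shows "(LINT x|I01. cmod (u x)) \<le> L2_norm u"
proof -
  define m where "m = (LINT x|I01. cmod (u x))"
  have i: "integrable I01 (\<lambda>x. cmod (u x))" using L2_imp_integrable[OF u] by auto
  have "0 \<le> (LINT x|I01. (cmod (u x) - m)\<^sup>2)" by simp
  also have "\<dots> = (LINT x|I01. (cmod (u x))\<^sup>2 + m\<^sup>2 - 2 * m * cmod (u x))"
    by (rule Bochner_Integration.integral_cong) (auto simp: power2_diff)
  also have "\<dots> = (L2_norm u)\<^sup>2 + m\<^sup>2 - 2 * m * m"
    using L2_integrable_power2[OF u] i integrable_const_I01[of "m\<^sup>2"]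
    by (simp add: L2_norm_power2 m_def[symmetric] measure_I01)
  finally have "m\<^sup>2 \<le> (L2_norm u)\<^sup>2" by (simp add: power2_eq_square)
  then show ?thesis unfolding m_def[symmetric] by (rule power2_le_imp_le) (rule L2_norm_nonneg)
qed

text \<open>Continuity up to the end points bounds \<open>a\<close>, so the essential supremum is finite and its
  conversion to a real number is faithful.\<close>

lemma AE_le_Linf_norm:
  assumes a: "continuous_on {0..1} a"
  shows "AE x in I01. cmod (a x) \<le> Linf_norm a"
proof -
  define e where "e = esssup I01 (\<lambda>x. ereal (cmod (a x)))"
  have AE: "AE x in I01. ereal (cmod (a x)) \<le> e"
    unfolding e_def by (rule esssup_AE)
  have m: "(\<lambda>x. ereal (cmod (a x))) \<in> borel_measurable I01"
    using continuous_measurable_I01[OF a] by measurable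
  have "bounded (a ` {0..1})"
    using a by (intro compact_imp_bounded compact_continuous_image) auto
  then obtain C where "\<And>x. x \<in> {0..1} \<Longrightarrow> cmod (a x) \<le> C"
    by (force simp: bounded_iff)
  then have "e \<le> ereal C"
    unfolding e_def by (intro esssup_I m AE_I01I) auto
  then show ?thesis
    using AE unfolding Linf_norm_def e_def[symmetric]
    by (cases e) (auto elim: eventually_mono)
qed

section \<open>Sobolev functions\<close>

lemma is_weak_derivD:
  "is_weak_deriv k u v \<Longrightarrow> test_fun f \<Longrightarrow>
    (LINT x|I01. (deriv ^^ k) f x *\<^sub>R u x) = (- 1) ^ k * (LINT x|I01. f x *\<^sub>R v x)"
  by (simp add: is_weak_deriv_def)

lemma weak_deriv_unique:
  assumes v: "v \<in> L2" "v' \<in> L2" and d: "is_weak_deriv k u v" "is_weak_deriv k u v'"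
  shows "AE x in I01. v x = v' x"
proof -
  have "AE x in I01. v x - v' x = 0"
  proof (rule fundamental_lemma)
    show "integrable I01 (\<lambda>x. v x - v' x)" using v by (intro L2_imp_integrable L2_diff)
    fix f assume f: "test_fun f"
    from is_weak_derivD[OF d(1) f] is_weak_derivD[OF d(2) f]
    have "(- 1) ^ k * (LINT x|I01. f x *\<^sub>R v x) = (- 1) ^ k * (LINT x|I01. f x *\<^sub>R v' x)"
      by (rule trans[OF sym])
    then have "(LINT x|I01. f x *\<^sub>R v x) = (LINT x|I01. f x *\<^sub>R v' x)" by simp
    then show "(LINT x|I01. f x *\<^sub>R (v x - v' x)) = 0"
      using v by (simp add: scaleR_diff_right integrable_test_fun_scaleR[OF L2_imp_integrable f])
  qed
  then show ?thesis by eventually_elim simp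
qed

lemma is_weak_deriv_0: "is_weak_deriv 0 u u"
  by (simp add: is_weak_deriv_def)

lemma weak_deriv_H:
  assumes "u \<in> H m" "k \<le> m"
  shows "weak_deriv k u \<in> L2" "is_weak_deriv k u (weak_deriv k u)"
proof -
  have "\<exists>v. v \<in> L2 \<and> is_weak_deriv k u v" using assms by (auto simp: H_def)
  from someI_ex[OF this] show "weak_deriv k u \<in> L2" "is_weak_deriv k u (weak_deriv k u)"
    by (auto simp: weak_deriv_def)
qed

text \<open>Through this lemma the choice made in \<^const>\<open>weak_deriv\<close> becomes irrelevant: any weak
  derivative that is known explicitly may replace it.\<close>

lemma weak_deriv_eq:
  assumes "v \<in> L2" "is_weak_deriv k u v"
  shows "weak_deriv k u \<in> L2" "AE x in I01. weak_deriv k u x = v x"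
    "L2_norm (weak_deriv k u) = L2_norm v"
proof -
  have "\<exists>v. v \<in> L2 \<and> is_weak_deriv k u v" using assms by auto
  from someI_ex[OF this] have *: "weak_deriv k u \<in> L2" "is_weak_deriv k u (weak_deriv k u)"
    by (auto simp: weak_deriv_def)
  then show "weak_deriv k u \<in> L2" "AE x in I01. weak_deriv k u x = v x"
    using weak_deriv_unique assms by blast+
  then show "L2_norm (weak_deriv k u) = L2_norm v"
    using assms by (intro L2_norm_cong_AE)
qed

lemma is_weak_deriv_lincomb:
  assumes "u \<in> L2" "w \<in> L2" "v \<in> L2" "y \<in> L2" "is_weak_deriv k u v" "is_weak_deriv k w y"
  shows "is_weak_deriv k (\<lambda>x. u x + c * w x) (\<lambda>x. v x + c * y x)"
  unfolding is_weak_deriv_def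
proof (intro allI impI)
  fix f assume f: "test_fun f"
  have lin: "(LINT x|I01. g x *\<^sub>R (u x + c * w x))
      = (LINT x|I01. g x *\<^sub>R u x) + c * (LINT x|I01. g x *\<^sub>R w x)"
    if "test_fun g" "u \<in> L2" "w \<in> L2" for g u w
    using integrable_test_fun_scaleR[OF L2_imp_integrable[OF that(2)] that(1)]
      integrable_test_fun_scaleR[OF L2_imp_integrable[OF that(3)] that(1)]
    by (simp add: scaleR_add_right mult_scaleR_right[symmetric] del: mult_scaleR_right)
  show "(LINT x|I01. (deriv ^^ k) f x *\<^sub>R (u x + c * w x))
      = (- 1) ^ k * (LINT x|I01. f x *\<^sub>R (v x + c * y x))"
    using assms(1-4) is_weak_derivD[OF assms(5) f] is_weak_derivD[OF assms(6) f]
    by (simp add: lin[OF f] lin[OF test_fun_deriv_funpow[OF f]] distrib_left mult.left_commute)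
qed

lemma H_lincomb:
  assumes u: "u \<in> H m" and w: "w \<in> H m"
  shows "(\<lambda>x. u x + c * w x) \<in> H m"
    and "k \<le> m \<Longrightarrow> AE x in I01. weak_deriv k (\<lambda>x. u x + c * w x) x = weak_deriv k u x + c * weak_deriv k w x"
    and "k \<le> m \<Longrightarrow> L2_norm (weak_deriv k (\<lambda>x. u x + c * w x)) = L2_norm (\<lambda>x. weak_deriv k u x + c * weak_deriv k w x)"
proof -
  have L: "u \<in> L2" "w \<in> L2" using u w by (auto simp: H_def)
  have *: "is_weak_deriv k (\<lambda>x. u x + c * w x) (\<lambda>x. weak_deriv k u x + c * weak_deriv k w x)"
    "(\<lambda>x. weak_deriv k u x + c * weak_deriv k w x) \<in> L2" if "k \<le> m" for k
    using L u w that by (auto intro!: is_weak_deriv_lincomb L2_lincomb weak_deriv_H)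
  then show "(\<lambda>x. u x + c * w x) \<in> H m"
    using L by (auto simp: H_def intro: L2_lincomb)
  show "AE x in I01. weak_deriv k (\<lambda>x. u x + c * w x) x = weak_deriv k u x + c * weak_deriv k w x"
    "L2_norm (weak_deriv k (\<lambda>x. u x + c * w x)) = L2_norm (\<lambda>x. weak_deriv k u x + c * weak_deriv k w x)"
    if "k \<le> m"
    using weak_deriv_eq[OF *(2,1)] that by auto
qed

text \<open>Weak derivatives of different orders are required of the same function \<open>u\<close>; that they
  are derivatives of one another follows because the derivative of a test function is a test
  function.\<close>

lemma is_weak_deriv_1_of_Suc:
  assumes "is_weak_deriv k u v" "is_weak_deriv (Suc k) u w"
  shows "is_weak_deriv 1 v w"
  unfolding is_weak_deriv_def
proof (intro allI impI)
  fix f assume f: "test_fun f"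
  have "(- 1) ^ k * (LINT x|I01. deriv f x *\<^sub>R v x) = (LINT x|I01. (deriv ^^ k) (deriv f) x *\<^sub>R u x)"
    using is_weak_derivD[OF assms(1) test_fun_deriv[OF f]] by (rule sym)
  also have "\<dots> = (LINT x|I01. (deriv ^^ Suc k) f x *\<^sub>R u x)"
    by (simp add: funpow_swap1)
  also have "\<dots> = (- 1) ^ Suc k * (LINT x|I01. f x *\<^sub>R w x)"
    by (rule is_weak_derivD[OF assms(2) f])
  finally have "(- 1) ^ k * (LINT x|I01. deriv f x *\<^sub>R v x) = (- 1) ^ k * (- (LINT x|I01. f x *\<^sub>R w x))"
    by simp
  then have "(LINT x|I01. deriv f x *\<^sub>R v x) = - (LINT x|I01. f x *\<^sub>R w x)"
    by (subst (asm) mult_cancel_left) simp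
  then show "(LINT x|I01. (deriv ^^ 1) f x *\<^sub>R v x) = (- 1) ^ 1 * (LINT x|I01. f x *\<^sub>R w x)"
    by simp
qed

lemma is_weak_deriv_Suc:
  assumes "is_weak_deriv 1 u v" "is_weak_deriv k v w"
  shows "is_weak_deriv (Suc k) u w"
  unfolding is_weak_deriv_def
proof (intro allI impI)
  fix f assume f: "test_fun f"
  have "(LINT x|I01. (deriv ^^ Suc k) f x *\<^sub>R u x) = - (LINT x|I01. (deriv ^^ k) f x *\<^sub>R v x)"
    using is_weak_derivD[OF assms(1) test_fun_deriv_funpow[OF f, of k]] by simp
  also have "\<dots> = (- 1) ^ Suc k * (LINT x|I01. f x *\<^sub>R w x)"
    using is_weak_derivD[OF assms(2) f] by simp
  finally show "(LINT x|I01. (deriv ^^ Suc k) f x *\<^sub>R u x) = (- 1) ^ Suc k * (LINT x|I01. f x *\<^sub>R w x)" .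
qed

lemma is_weak_deriv_classical:
  assumes d: "\<And>x. x \<in> {0..1} \<Longrightarrow> (q has_vector_derivative q' x) (at x within {0..1})"
    and c: "continuous_on {0..1} q'"
  shows "is_weak_deriv 1 q q'"
proof (rule weak_deriv_prim)
  show i: "integrable I01 q'" by (rule integrable_continuous_I01[OF c])
  have "continuous_on {0..1} q"
    unfolding continuous_on_eq_continuous_within using has_vector_derivative_continuous[OF d] by blast
  then show "q \<in> borel_measurable I01" by (rule continuous_measurable_I01)
  show "AE x in I01. q x = q 0 + prim q' x"
  proof (rule AE_I01I)
    fix x :: real assume x: "0 < x" "x < 1"
    have "prim q' x = integral {0..x} q'"
      unfolding prim_def using x by (intro LINT_lessThan_eq_integral i) auto
    also have "\<dots> = q x - q 0"
      by (intro integral_unique fundamental_theorem_of_calculus)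
        (use x in \<open>auto intro!: has_vector_derivative_within_subset[OF d]\<close>)
    finally show "q x = q 0 + prim q' x" by simp
  qed
qed

lemma H_norm_power2: "(H_norm m u)\<^sup>2 = (\<Sum>k\<le>m. (L2_norm (weak_deriv k u))\<^sup>2)"
  by (simp add: H_norm_def sum_nonneg)

lemma H_norm_nonneg: "0 \<le> H_norm m u"
  by (simp add: H_norm_def sum_nonneg)

lemma H_imp_L2: "u \<in> H m \<Longrightarrow> u \<in> L2"
  by (simp add: H_def)

lemma weak_deriv_1_weak_deriv_1:
  assumes "u \<in> H m" "2 \<le> m"
  shows "is_weak_deriv 1 (weak_deriv 1 u) (weak_deriv 2 u)"
proof (rule is_weak_deriv_1_of_Suc)
  show "is_weak_deriv 1 u (weak_deriv 1 u)"
    by (rule weak_deriv_H(2)[OF assms(1)]) (use assms(2) in simp)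
  show "is_weak_deriv (Suc 1) u (weak_deriv 2 u)"
    unfolding Suc_1 by (rule weak_deriv_H(2)[OF assms])
qed

lemma H_norm_add_power2_le:
  assumes u: "u \<in> H m" and w: "w \<in> H m"
  shows "(H_norm m (\<lambda>x. u x + w x))\<^sup>2 \<le> 2 * (H_norm m u)\<^sup>2 + 2 * (H_norm m w)\<^sup>2"
proof -
  have "(L2_norm (weak_deriv k (\<lambda>x. u x + w x)))\<^sup>2
      \<le> 2 * (L2_norm (weak_deriv k u))\<^sup>2 + 2 * (L2_norm (weak_deriv k w))\<^sup>2" if "k \<le> m" for k
    using H_lincomb(3)[OF u w that, of 1] L2_add(2)[OF weak_deriv_H(1)[OF u that] weak_deriv_H(1)[OF w that]]
    by simp
  then have "(\<Sum>k\<le>m. (L2_norm (weak_deriv k (\<lambda>x. u x + w x)))\<^sup>2)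
      \<le> (\<Sum>k\<le>m. 2 * (L2_norm (weak_deriv k u))\<^sup>2 + 2 * (L2_norm (weak_deriv k w))\<^sup>2)"
    by (intro sum_mono) auto
  then show ?thesis by (simp add: H_norm_power2 sum.distrib sum_distrib_left)
qed

lemma cont_rep_H1:
  assumes "u \<in> L2" "v \<in> L2" "is_weak_deriv 1 u v"
  shows "continuous_on {0..1} (cont_rep u)" "AE x in I01. u x = cont_rep u x"
proof -
  note i = L2_imp_integrable[OF assms(1)] L2_imp_integrable[OF assms(2)] assms(3)
  have "continuous_on {0..1} (\<lambda>x. cont_rep u 0 + prim v x)"
    by (intro continuous_intros continuous_on_prim i)
  then show "continuous_on {0..1} (cont_rep u)"
    by (rule continuous_on_eq) (rule cont_rep_weak_deriv(2)[OF i, symmetric])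
  have "AE x in I01. cont_rep u x = cont_rep u 0 + prim v x"
    by (rule AE_I01I, rule cont_rep_weak_deriv(2)[OF i]) simp
  with cont_rep_weak_deriv(1)[OF i] show "AE x in I01. u x = cont_rep u x"
    by eventually_elim simp
qed

lemma trace_lincomb:
  assumes u: "u \<in> H m" and w: "w \<in> H m" and m: "2 \<le> m" and x: "x \<in> {0..1}"
  shows "cont_rep (\<lambda>x. u x + c * w x) x = cont_rep u x + c * cont_rep w x"
    and "cont_rep (weak_deriv 1 (\<lambda>x. u x + c * w x)) x
      = cont_rep (weak_deriv 1 u) x + c * cont_rep (weak_deriv 1 w) x"
proof -
  have *: "continuous_on {0..1} (cont_rep y)" "AE x in I01. y x = cont_rep y x"
     "continuous_on {0..1} (cont_rep (weak_deriv 1 y))"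
     "AE x in I01. weak_deriv 1 y x = cont_rep (weak_deriv 1 y) x" if y: "y \<in> H m" for y
  proof -
    note d = weak_deriv_H[OF y, of 1] weak_deriv_H[OF y, of 2]
    show "continuous_on {0..1} (cont_rep y)" "AE x in I01. y x = cont_rep y x"
      by (rule cont_rep_H1[OF H_imp_L2[OF y] d(1) d(2)]; use m in simp)+
    show "continuous_on {0..1} (cont_rep (weak_deriv 1 y))"
      "AE x in I01. weak_deriv 1 y x = cont_rep (weak_deriv 1 y) x"
      by (rule cont_rep_H1[OF d(1) d(3) weak_deriv_1_weak_deriv_1[OF y m]]; use m in simp)+
  qed
  show "cont_rep (\<lambda>x. u x + c * w x) x = cont_rep u x + c * cont_rep w x"
  proof (rule cont_rep_eq[OF _ _ x])
    show "AE x in I01. u x + c * w x = cont_rep u x + c * cont_rep w x"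
      using *(2)[OF u] *(2)[OF w] by eventually_elim simp
  qed (intro continuous_intros *(1) u w)
  show "cont_rep (weak_deriv 1 (\<lambda>x. u x + c * w x)) x
      = cont_rep (weak_deriv 1 u) x + c * cont_rep (weak_deriv 1 w) x"
  proof (rule cont_rep_eq[OF _ _ x])
    have "1 \<le> m" using m by simp
    from H_lincomb(2)[OF u w this, of c] *(4)[OF u] *(4)[OF w]
    show "AE x in I01. weak_deriv 1 (\<lambda>x. u x + c * w x) x
      = cont_rep (weak_deriv 1 u) x + c * cont_rep (weak_deriv 1 w) x"
      by eventually_elim simp
  qed (intro continuous_intros *(3) u w)
qed

lemma L_op_L2:
  assumes a: "continuous_on {0..1} a" and b: "continuous_on {0..1} b" and u: "u \<in> H m" "2 \<le> m"
  shows "L_op a b u \<in> L2"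
  unfolding L_op_def
  by (intro L2_add(1) L2_mult_bounded[OF continuous_measurable_I01 AE_le_Linf_norm] a b
      H_imp_L2[OF u(1)] weak_deriv_H(1)[OF u(1)]) (use u(2) in auto)

lemma L_op_lincomb:
  assumes u: "u \<in> H m" and w: "w \<in> H m" and m: "2 \<le> m"
  shows "AE x in I01. L_op a b (\<lambda>x. u x + c * w x) x = L_op a b u x + c * L_op a b w x"
proof -
  have "1 \<le> m" using m by simp
  from H_lincomb(2)[OF u w this, of c] H_lincomb(2)[OF u w m, of c] show ?thesis
    by eventually_elim (simp add: L_op_def algebra_simps)
qed

section \<open>A small function with prescribed boundary values\<close>

text \<open>Its value at 0 is \<open>c0\<close> and its derivative \<open>c1 (1 - x)\<close> equals \<open>c1\<close> at 0 and vanishes at 1.\<close>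

definition boundary_lift :: "complex \<Rightarrow> complex \<Rightarrow> real \<Rightarrow> complex" where
  "boundary_lift c0 c1 x = c0 + c1 * of_real (x - x\<^sup>2 / 2)"

lemma weak_deriv_boundary_lift:
  shows "is_weak_deriv 1 (boundary_lift c0 c1) (\<lambda>x. c1 * of_real (1 - x))"
    and "is_weak_deriv 2 (boundary_lift c0 c1) (\<lambda>x. - c1)"
    and "is_weak_deriv 3 (boundary_lift c0 c1) (\<lambda>x. 0)"
proof -
  show 1: "is_weak_deriv 1 (boundary_lift c0 c1) (\<lambda>x. c1 * of_real (1 - x))"
  proof (rule is_weak_deriv_classical)
    show "(boundary_lift c0 c1 has_vector_derivative c1 * of_real (1 - x)) (at x within {0..1})" for x
      unfolding boundary_lift_def[abs_def]
      by (rule derivative_eq_intros refl | simp)+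
  qed (intro continuous_intros)
  have 2: "is_weak_deriv 1 (\<lambda>x. c1 * of_real (1 - x)) (\<lambda>x. - c1)"
  proof (rule is_weak_deriv_classical)
    show "((\<lambda>x. c1 * of_real (1 - x)) has_vector_derivative - c1) (at x within {0..1})" for x
      by (rule derivative_eq_intros refl | simp)+
  qed (intro continuous_intros)
  have 3: "is_weak_deriv 1 (\<lambda>x. - c1) (\<lambda>x. 0)"
    by (rule is_weak_deriv_classical) (auto intro!: derivative_eq_intros)
  show "is_weak_deriv 2 (boundary_lift c0 c1) (\<lambda>x. - c1)"
    using is_weak_deriv_Suc[OF 1 2] by (simp add: numeral_2_eq_2)
  show "is_weak_deriv 3 (boundary_lift c0 c1) (\<lambda>x. 0)"
    using is_weak_deriv_Suc[OF 1 is_weak_deriv_Suc[OF 2 3]] by (simp add: numeral_3_eq_3)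
qed

lemma continuous_L2: "continuous_on {0..1} u \<Longrightarrow> u \<in> L2"
  using L2_bounded(1)[OF continuous_measurable_I01 AE_le_Linf_norm] by blast

lemma boundary_lift_H3: "boundary_lift c0 c1 \<in> H 3"
proof -
  have "boundary_lift c0 c1 \<in> L2" unfolding boundary_lift_def[abs_def] by (intro continuous_L2 continuous_intros) auto
  moreover have "\<exists>v\<in>L2. is_weak_deriv k (boundary_lift c0 c1) v" if "k \<le> 3" for k
  proof -
    have "k = 0 \<or> k = 1 \<or> k = 2 \<or> k = 3" using that by presburger
    then consider "k = 0" | "k = 1" | "k = 2" | "k = 3" by blast
    then show ?thesis
    proof cases
      case 1 then show ?thesis using \<open>boundary_lift c0 c1 \<in> L2\<close> is_weak_deriv_0 by blast
    next
      case 2 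
      have "(\<lambda>x. c1 * of_real (1 - x)) \<in> L2" by (intro continuous_L2 continuous_intros)
      with 2 weak_deriv_boundary_lift(1) show ?thesis by blast
    next
      case 3 
      have "(\<lambda>x. - c1) \<in> L2" by (intro continuous_L2 continuous_intros)
      with 3 weak_deriv_boundary_lift(2) show ?thesis by blast
    next
      case 4 
      have "(\<lambda>x. 0) \<in> L2" by (intro continuous_L2 continuous_intros)
      with 4 weak_deriv_boundary_lift(3) show ?thesis by blast
    qed
  qed
  ultimately show ?thesis by (auto simp: H_def)
qed

lemma boundary_lift_traces:
  "cont_rep (boundary_lift c0 c1) 0 = c0"
  "cont_rep (weak_deriv 1 (boundary_lift c0 c1)) 0 = c1"
  "cont_rep (weak_deriv 1 (boundary_lift c0 c1)) 1 = 0"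
proof -
  have "cont_rep (boundary_lift c0 c1) 0 = boundary_lift c0 c1 0"
    by (rule cont_rep_eq) (auto simp: boundary_lift_def intro!: continuous_intros)
  then show "cont_rep (boundary_lift c0 c1) 0 = c0" by (simp add: boundary_lift_def)
  have c: "continuous_on {0..1} (\<lambda>x. c1 * complex_of_real (1 - x))" by (intro continuous_intros)
  have "cont_rep (weak_deriv 1 (boundary_lift c0 c1)) x = c1 * of_real (1 - x)" if "x \<in> {0..1}" for x
    by (rule cont_rep_eq[OF c weak_deriv_eq(2)[OF continuous_L2[OF c] weak_deriv_boundary_lift(1)] that])
  from this[of 0] this[of 1] show "cont_rep (weak_deriv 1 (boundary_lift c0 c1)) 0 = c1"
    "cont_rep (weak_deriv 1 (boundary_lift c0 c1)) 1 = 0" by auto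
qed

lemma boundary_lift_bounds:
  assumes "cmod c0 \<le> \<delta>" "cmod c1 \<le> \<delta>"
  shows "AE x in I01. cmod (boundary_lift c0 c1 x) \<le> 2 * \<delta>"
    and "AE x in I01. cmod (weak_deriv 1 (boundary_lift c0 c1) x) \<le> \<delta>"
    and "AE x in I01. cmod (weak_deriv 2 (boundary_lift c0 c1) x) \<le> \<delta>"
    and "(H_norm 3 (boundary_lift c0 c1))\<^sup>2 \<le> 6 * \<delta>\<^sup>2"
proof -
  have \<delta>: "0 \<le> \<delta>" using assms(1) norm_ge_zero order_trans by blast
  show b0: "AE x in I01. cmod (boundary_lift c0 c1 x) \<le> 2 * \<delta>"
  proof (rule AE_I01I)
    fix x :: real assume x: "0 < x" "x < 1"
    have "x\<^sup>2 \<le> x" using x by (simp add: power2_eq_square mult_left_le)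
    then have "\<bar>x - x\<^sup>2 / 2\<bar> \<le> 1" using x by (smt (verit) zero_le_power2 field_sum_of_halves)
    then have "cmod (c1 * of_real (x - x\<^sup>2 / 2)) \<le> cmod c1 * 1"
      unfolding norm_mult norm_of_real by (intro mult_left_mono) auto
    then show "cmod (boundary_lift c0 c1 x) \<le> 2 * \<delta>"
      using assms norm_triangle_ineq[of c0 "c1 * of_real (x - x\<^sup>2 / 2)"] by (simp add: boundary_lift_def)
  qed
  have c: "continuous_on {0..1} (\<lambda>x. c1 * complex_of_real (1 - x))" by (intro continuous_intros)
  have c': "(\<lambda>x. - c1) \<in> L2" "(\<lambda>x. 0) \<in> L2" by (intro continuous_L2 continuous_intros)+
  show b1: "AE x in I01. cmod (weak_deriv 1 (boundary_lift c0 c1) x) \<le> \<delta>"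
  proof -
    have "AE x in I01. cmod (c1 * of_real (1 - x)) \<le> \<delta>"
    proof (rule AE_I01I)
      fix x :: real assume x: "0 < x" "x < 1"
      have "cmod (c1 * of_real (1 - x)) \<le> cmod c1 * 1"
        unfolding norm_mult norm_of_real using x by (intro mult_left_mono) auto
      with assms show "cmod (c1 * of_real (1 - x)) \<le> \<delta>" by simp
    qed
    with weak_deriv_eq(2)[OF continuous_L2[OF c] weak_deriv_boundary_lift(1)[of c0 c1]] show ?thesis
      by eventually_elim simp
  qed
  show b2: "AE x in I01. cmod (weak_deriv 2 (boundary_lift c0 c1) x) \<le> \<delta>"
    using weak_deriv_eq(2)[OF c'(1) weak_deriv_boundary_lift(2)[of c0 c1]]
    by eventually_elim (use assms in simp)
  have m: "weak_deriv k (boundary_lift c0 c1) \<in> borel_measurable I01" if "k \<le> 3" for k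
    by (intro L2_measurable weak_deriv_H[OF boundary_lift_H3 that])
  have "AE x in I01. weak_deriv 0 (boundary_lift c0 c1) x = boundary_lift c0 c1 x"
    using weak_deriv_eq(2)[OF H_imp_L2[OF boundary_lift_H3] is_weak_deriv_0] .
  with b0 have b0': "AE x in I01. cmod (weak_deriv 0 (boundary_lift c0 c1) x) \<le> 2 * \<delta>"
    by eventually_elim simp
  have b3: "L2_norm (weak_deriv 3 (boundary_lift c0 c1)) = 0"
    using weak_deriv_eq(3)[OF c'(2) weak_deriv_boundary_lift(3)[of c0 c1]] by (simp add: L2_norm_def)
  have "{..3::nat} = {0, 1, 2, 3}" by auto
  then show "(H_norm 3 (boundary_lift c0 c1))\<^sup>2 \<le> 6 * \<delta>\<^sup>2"
    using L2_bounded(2)[OF m b0'] L2_bounded(2)[OF m b1] L2_bounded(2)[OF m b2] b3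
    by (simp add: H_norm_power2 power_mult_distrib)
qed

section \<open>Stability of the initial value problem\<close>

text \<open>Let \<open>M\<close> be the maximum of \<open>f x * exp (- K x)\<close>, attained at \<open>y\<close>. Inserting
  \<open>f t \<le> M * exp (K t)\<close> into the hypothesis at \<open>y\<close> leaves \<open>M \<le> c\<close>.\<close>

lemma Gronwall:
  fixes f :: "real \<Rightarrow> real"
  assumes f: "continuous_on {0..1} f" and K: "0 \<le> K" and c: "0 \<le> c"
    and le: "\<And>x. x \<in> {0..1} \<Longrightarrow> f x \<le> c + K * integral {0..x} f"
    and x: "x \<in> {0..1}"
  shows "f x \<le> c * exp K"
proof -
  have "continuous_on {0..1} (\<lambda>x. f x * exp (- (K * x)))"
    by (intro continuous_intros f)
  then obtain y where y: "y \<in> {0..1}" "\<And>x. x \<in> {0..1} \<Longrightarrow> f x * exp (- (K * x)) \<le> f y * exp (- (K * y))"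
    using continuous_attains_sup[of "{0..1::real}" "\<lambda>x. f x * exp (- (K * x))"] by auto
  define M where "M = f y * exp (- (K * y))"
  have fM: "f x \<le> M * exp (K * x)" if "x \<in> {0..1}" for x
    using y(2)[OF that] by (simp add: M_def exp_minus field_simps)
  have "K * integral {0..y} f = integral {0..y} (\<lambda>t. K * f t)" by simp
  also have "\<dots> \<le> integral {0..y} (\<lambda>t. M * (exp (K * t) * K))"
  proof (rule integral_le)
    fix t assume "t \<in> {0..y}"
    then show "K * f t \<le> M * (exp (K * t) * K)"
      using mult_left_mono[OF fM[of t] K] y(1) by (simp add: mult_ac)
  qed (use y(1) in \<open>auto intro!: integrable_continuous_real continuous_intros
      continuous_on_subset[OF f]\<close>)
  also have "\<dots> = M * exp (K * y) - M * exp (K * 0)"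
    by (intro integral_unique fundamental_theorem_of_calculus)
      (use y(1) in \<open>auto simp flip: has_real_derivative_iff_has_vector_derivative
         intro!: derivative_eq_intros\<close>)
  finally have "f y \<le> c + (M * exp (K * y) - M)" using le[OF y(1)] by simp
  moreover have "f y = M * exp (K * y)" by (simp add: M_def exp_minus)
  ultimately have "M \<le> c" by simp
  have "f x \<le> M * exp (K * x)" by (rule fM[OF x])
  also have "\<dots> \<le> c * exp K"
    using \<open>M \<le> c\<close> c x K by (intro mult_mono) (auto intro: mult_left_le)
  finally show ?thesis .
qed

text \<open>The functions \<open>u0\<close>, \<open>u1\<close>, \<open>u2\<close> stand for a solution and its first two derivatives.
  Writing \<open>u0\<close> and \<open>u1\<close> as initial value plus integral of the next function, and replacing \<open>u2\<close>
  by means of the equation, gives an integral inequality for \<open>|u0| + |u1|\<close>.\<close>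

lemma ODE_stability:
  assumes L: "u0 \<in> L2" "u1 \<in> L2" "u2 \<in> L2" and d: "is_weak_deriv 1 u0 u1" "is_weak_deriv 1 u1 u2"
    and a: "a \<in> borel_measurable I01" "AE x in I01. cmod (a x) \<le> A" "0 \<le> A"
    and b: "b \<in> borel_measurable I01" "AE x in I01. cmod (b x) \<le> B" "0 \<le> B"
  defines "F \<equiv> \<lambda>x. u2 x + a x * u1 x + b x * u0 x"
    and "K \<equiv> 1 + A + B"
  defines "m \<equiv> cmod (cont_rep u0 0) + cmod (cont_rep u1 0) + L2_norm F"
  shows "(L2_norm u0)\<^sup>2 + (L2_norm u1)\<^sup>2 + (L2_norm u2)\<^sup>2 \<le> 6 * K\<^sup>2 * (exp K)\<^sup>2 * m\<^sup>2"
proof -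
  have K: "K \<ge> 1" using a b by (simp add: K_def)
  have FL: "F \<in> L2" unfolding F_def
    by (intro L2_add(1) L2_mult_bounded[OF a(1,2)] L2_mult_bounded[OF b(1,2)] L)
  note i = L[THEN L2_imp_integrable]
  note rep0 = cont_rep_H1[OF L(1,2) d(1)] and rep1 = cont_rep_H1[OF L(2,3) d(2)]
  define f where "f x = cmod (cont_rep u0 x) + cmod (cont_rep u1 x)" for x
  have cf: "continuous_on {0..1} f"
    unfolding f_def by (intro continuous_intros rep0 rep1)
  have m0: "0 \<le> m" by (simp add: m_def L2_norm_nonneg)
  have AE_u: "AE x in I01. u0 x = cont_rep u0 x" "AE x in I01. u1 x = cont_rep u1 x"
    by (fact rep0 rep1)+
  have u2_le: "AE x in I01. cmod (u2 x) \<le> cmod (F x) + (A + B) * f x"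
    using AE_u a(2) b(2)
  proof eventually_elim
    case (elim x)
    have "u2 x = F x + (- (a x * u1 x) + - (b x * u0 x))" by (simp add: F_def)
    then have "cmod (u2 x) \<le> cmod (F x) + (cmod (a x) * cmod (u1 x) + cmod (b x) * cmod (u0 x))"
      by (metis norm_minus_cancel norm_mult norm_triangle_ineq norm_triangle_mono order_refl)
    also have "cmod (a x) * cmod (u1 x) \<le> A * f x"
      using elim a(3) by (intro mult_mono) (auto simp: f_def)
    also have "cmod (b x) * cmod (u0 x) \<le> B * f x"
      using elim b(3) by (intro mult_mono) (auto simp: f_def)
    finally show ?case by (simp add: algebra_simps)
  qed
  have f_le: "f x \<le> m + K * integral {0..x} f" if x: "x \<in> {0..1}" for x
  proof -
    let ?I = "\<lambda>t. indicator {..<x} t :: real"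
    have int: "integrable I01 (\<lambda>t. ?I t * g t)" if "integrable I01 g" for g :: "real \<Rightarrow> real"
      using integrable_prim_integrand[OF that, of "{..<x}"] by simp
    have int_f: "integrable I01 f" by (rule integrable_continuous_I01[OF cf])
    have int_F: "integrable I01 (\<lambda>t. cmod (F t))" using L2_imp_integrable[OF FL] by auto
    have "f x \<le> (cmod (cont_rep u0 0) + cmod (prim u1 x)) + (cmod (cont_rep u1 0) + cmod (prim u2 x))"
      unfolding f_def using cont_rep_weak_deriv(2)[OF i(1,2) d(1) x] cont_rep_weak_deriv(2)[OF i(2,3) d(2) x]
      by (metis add_mono norm_triangle_ineq)
    also have "cmod (prim u1 x) \<le> (LINT t|I01. ?I t * f t)"
    proof (rule order_trans[OF norm_prim_le])
      show "(LINT t|I01. ?I t * cmod (u1 t)) \<le> (LINT t|I01. ?I t * f t)"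
      proof (intro integral_mono_AE int int_f)
        show "integrable I01 (\<lambda>t. cmod (u1 t))" using i by auto
        show "AE t in I01. ?I t * cmod (u1 t) \<le> ?I t * f t"
          using AE_u by eventually_elim (auto simp: f_def intro!: mult_left_mono)
      qed
    qed
    also have "cmod (prim u2 x) \<le> (LINT t|I01. cmod (F t) + (A + B) * (?I t * f t))"
    proof (rule order_trans[OF norm_prim_le])
      show "(LINT t|I01. ?I t * cmod (u2 t)) \<le> (LINT t|I01. cmod (F t) + (A + B) * (?I t * f t))"
      proof (intro integral_mono_AE int)
        show "integrable I01 (\<lambda>t. cmod (u2 t))" using i by auto
        show "integrable I01 (\<lambda>t. cmod (F t) + (A + B) * (?I t * f t))"
          using int_F int[OF int_f] by auto
        show "AE t in I01. ?I t * cmod (u2 t) \<le> cmod (F t) + (A + B) * (?I t * f t)"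
          using u2_le by eventually_elim (auto simp: indicator_def)
      qed
    qed
    also have "\<dots> = (LINT t|I01. cmod (F t)) + (A + B) * (LINT t|I01. ?I t * f t)"
      using int_F int[OF int_f] by simp
    also have "(LINT t|I01. cmod (F t)) \<le> L2_norm F" by (rule L1_le_L2_norm[OF FL])
    also have "(LINT t|I01. ?I t * f t) = integral {0..x} f"
      using LINT_lessThan_eq_integral[OF int_f x] by simp
    finally show ?thesis by (simp add: m_def K_def algebra_simps)
  qed
  define M where "M = m * exp K"
  have M0: "0 \<le> M" using m0 by (simp add: M_def)
  have fM: "f x \<le> M" if "x \<in> {0..1}" for x
    unfolding M_def using K by (intro Gronwall[OF cf _ m0 f_le that]) auto
  have AE_f: "AE x in I01. f x \<le> M" by (intro AE_I01I fM) auto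
  have "(L2_norm u0)\<^sup>2 \<le> M\<^sup>2"
  proof (rule L2_bounded(2)[OF L2_measurable[OF L(1)]])
    show "AE x in I01. cmod (u0 x) \<le> M"
      using AE_u AE_f by eventually_elim (simp add: f_def, smt (verit) norm_ge_zero)
  qed
  moreover have "(L2_norm u1)\<^sup>2 \<le> M\<^sup>2"
  proof (rule L2_bounded(2)[OF L2_measurable[OF L(2)]])
    show "AE x in I01. cmod (u1 x) \<le> M"
      using AE_u AE_f by eventually_elim (simp add: f_def, smt (verit) norm_ge_zero)
  qed
  moreover have "(L2_norm u2)\<^sup>2 \<le> 2 * m\<^sup>2 + 2 * (K * M)\<^sup>2"
  proof -
    have "(L2_norm u2)\<^sup>2 \<le> (LINT x|I01. 2 * (cmod (F x))\<^sup>2 + 2 * (K * M)\<^sup>2)"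
    proof (rule L2_dominated(2)[OF L2_measurable[OF L(3)]])
      show "integrable I01 (\<lambda>x. 2 * (cmod (F x))\<^sup>2 + 2 * (K * M)\<^sup>2)"
        by (intro Bochner_Integration.integrable_add integrable_const_I01
            integrable_mult_right L2_integrable_power2 FL)
      show "AE x in I01. (cmod (u2 x))\<^sup>2 \<le> 2 * (cmod (F x))\<^sup>2 + 2 * (K * M)\<^sup>2"
        using u2_le AE_f
      proof eventually_elim
        case (elim x)
        have "(A + B) * f x \<le> K * M"
          using elim a(3) b(3) M0 by (intro mult_mono) (auto simp: K_def f_def)
        with elim have "cmod (u2 x) \<le> cmod (F x) + K * M" by simp
        then have "(cmod (u2 x))\<^sup>2 \<le> (cmod (F x) + K * M)\<^sup>2" by (intro power_mono) auto
        also have "\<dots> \<le> 2 * (cmod (F x))\<^sup>2 + 2 * (K * M)\<^sup>2"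
          using norm_add_power2_le[of "cmod (F x)" "K * M"] by simp
        finally show ?case .
      qed
    qed
    also have "\<dots> = 2 * (L2_norm F)\<^sup>2 + 2 * (K * M)\<^sup>2"
      using L2_integrable_power2[OF FL]
      by (subst Bochner_Integration.integral_add)
        (simp_all add: integrable_const_I01 L2_norm_power2 measure_I01)
    also have "(L2_norm F)\<^sup>2 \<le> m\<^sup>2"
      by (intro power_mono L2_norm_nonneg) (simp add: m_def)
    finally show ?thesis by simp
  qed
  moreover have "m\<^sup>2 \<le> M\<^sup>2"
    using K m0 by (intro power_mono) (auto simp: M_def intro: mult_right_le_one_le order_trans[OF _ mult_left_mono[of 1 "exp K"]])
  moreover have "M\<^sup>2 \<le> (K * M)\<^sup>2"
    using K M0 by (intro power_mono) (auto simp: mult_le_cancel_right1)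
  ultimately have "(L2_norm u0)\<^sup>2 + (L2_norm u1)\<^sup>2 + (L2_norm u2)\<^sup>2 \<le> 6 * (K * M)\<^sup>2"
    by linarith
  then show ?thesis by (simp add: M_def power_mult_distrib mult_ac)
qed


section \<open>The minimizer\<close>

text \<open>The value of the functional at the minimizer does not exceed its value at
  \<open>ws + boundary_lift c0 c1\<close>, the correction being chosen so that the boundary conditions for the
  noisy data hold. There the residual is \<open>ds - d\<close> plus the image of the correction, of
  size \<open>O(\<delta>)\<close>.\<close>

lemma minimizer_residual_bound:
  assumes a: "continuous_on {0..1} a" and b: "continuous_on {0..1} b"
    and d: "d \<in> L2" "ds \<in> L2" and \<alpha>: "0 < \<alpha>" "\<alpha> < 1"
    and ws: "ws \<in> H 3" "AE x in I01. L_op a b ws x = ds x" "cont_rep (weak_deriv 1 ws) 1 = 0"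
    and \<delta>: "L2_norm (\<lambda>x. d x - ds x) \<le> \<delta>" "cmod (p0 - cont_rep ws 0) \<le> \<delta>"
      "cmod (p1 - cont_rep (weak_deriv 1 ws) 0) \<le> \<delta>"
    and min: "is_arg_min (J a b d \<alpha>) (\<lambda>w. w \<in> W p0 p1) w\<alpha>"
  defines "K \<equiv> 1 + \<bar>Linf_norm a\<bar> + \<bar>Linf_norm b\<bar>"
  shows "(L2_norm (\<lambda>x. L_op a b w\<alpha> x - d x))\<^sup>2 \<le> 22 * K\<^sup>2 * \<delta>\<^sup>2 + 2 * \<alpha> * (H_norm 3 ws)\<^sup>2"
proof -
  define c0 where "c0 = p0 - cont_rep ws 0"
  define c1 where "c1 = p1 - cont_rep (weak_deriv 1 ws) 0"
  define q where "q = boundary_lift c0 c1"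
  \<comment> \<open>The factor 1 makes \<open>y\<close> literally an instance of the lemmas on linear combinations.\<close>
  define y where "y = (\<lambda>x. ws x + 1 * q x)"
  have \<delta>0: "0 \<le> \<delta>" using \<delta>(2) norm_ge_zero order_trans by blast
  define A where "A = \<bar>Linf_norm a\<bar>"
  define B where "B = \<bar>Linf_norm b\<bar>"
  have AB: "0 \<le> A" "0 \<le> B" "K = 1 + A + B" by (simp_all add: A_def B_def K_def)
  then have K1: "1 \<le> K" by simp
  have order_two_three: "(2::nat) \<le> 3" by simp
  have q: "q \<in> H 3" unfolding q_def by (rule boundary_lift_H3)
  have qb: "AE x in I01. cmod (q x) \<le> 2 * \<delta>" "AE x in I01. cmod (weak_deriv 1 q x) \<le> \<delta>"
    "AE x in I01. cmod (weak_deriv 2 q x) \<le> \<delta>" "(H_norm 3 q)\<^sup>2 \<le> 6 * \<delta>\<^sup>2"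
    unfolding q_def by (intro boundary_lift_bounds; use \<delta> in \<open>simp add: c0_def c1_def\<close>)+
  have y: "y \<in> H 3" unfolding y_def by (rule H_lincomb(1)[OF ws(1) q])
  have "y \<in> W p0 p1"
    using y trace_lincomb[OF ws(1) q order_two_three, of 0 1] trace_lincomb[OF ws(1) q order_two_three, of 1 1] ws(3)
    by (simp add: W_def y_def q_def boundary_lift_traces c0_def c1_def del: One_nat_def)
  then have J_le: "J a b d \<alpha> w\<alpha> \<le> J a b d \<alpha> y"
    using min by (auto simp: is_arg_min_def not_less)
  have y_L2: "L_op a b y \<in> L2" by (rule L_op_L2[OF a b y]) simp
  have q_L2: "L_op a b q \<in> L2" by (rule L_op_L2[OF a b q]) simp
  have Lq: "(L2_norm (L_op a b q))\<^sup>2 \<le> (2 * K * \<delta>)\<^sup>2"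
  proof (rule L2_bounded(2)[OF L2_measurable[OF q_L2]])
    show "AE x in I01. cmod (L_op a b q x) \<le> 2 * K * \<delta>"
      using qb(1-3) AE_le_Linf_norm[OF a] AE_le_Linf_norm[OF b]
    proof eventually_elim
      case (elim x)
      have "cmod (L_op a b q x) \<le> cmod (weak_deriv 2 q x) + cmod (a x) * cmod (weak_deriv 1 q x) + cmod (b x) * cmod (q x)"
        unfolding L_op_def by (metis norm_triangle_mono norm_mult order_refl)
      also have "cmod (a x) * cmod (weak_deriv 1 q x) \<le> A * \<delta>"
        using elim AB(1,2) \<delta>0 by (intro mult_mono) (auto simp: A_def)
      also have "cmod (b x) * cmod (q x) \<le> B * (2 * \<delta>)"
        using elim AB(1,2) \<delta>0 by (intro mult_mono) (auto simp: B_def)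
      also have "cmod (weak_deriv 2 q x) \<le> \<delta>" using elim by simp
      also have "\<delta> + A * \<delta> + B * (2 * \<delta>) \<le> 2 * K * \<delta>"
        using \<delta>0 mult_nonneg_nonneg[OF AB(1) \<delta>0] by (simp add: AB(3) distrib_left distrib_right)
      finally show ?case by simp
    qed
  qed
  have "(L2_norm (\<lambda>x. L_op a b y x - d x))\<^sup>2 \<le> 2 * \<delta>\<^sup>2 + 2 * (2 * K * \<delta>)\<^sup>2"
  proof -
    have r: "(\<lambda>x. ds x - d x) \<in> L2" by (rule L2_diff[OF d(2,1)])
    have "AE x in I01. L_op a b y x - d x = (ds x - d x) + L_op a b q x"
      using ws(2) L_op_lincomb[OF ws(1) q order_two_three, of a b 1] unfolding y_def by eventually_elim simp
    then have "L2_norm (\<lambda>x. L_op a b y x - d x) = L2_norm (\<lambda>x. (ds x - d x) + L_op a b q x)"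
      by (intro L2_norm_cong_AE L2_diff L2_add(1) y_L2 q_L2 d)
    moreover have "L2_norm (\<lambda>x. ds x - d x) = L2_norm (\<lambda>x. d x - ds x)"
      by (simp add: L2_norm_def norm_minus_commute)
    then have "(L2_norm (\<lambda>x. ds x - d x))\<^sup>2 \<le> \<delta>\<^sup>2"
      using \<delta>(1) by (simp add: power_mono L2_norm_nonneg)
    ultimately show ?thesis using L2_add(2)[OF r q_L2] Lq by simp
  qed
  moreover have "\<alpha> * (H_norm 3 y)\<^sup>2 \<le> 2 * \<alpha> * (H_norm 3 ws)\<^sup>2 + 12 * \<delta>\<^sup>2"
  proof -
    have "(H_norm 3 y)\<^sup>2 \<le> 2 * (H_norm 3 ws)\<^sup>2 + 12 * \<delta>\<^sup>2"
      using H_norm_add_power2_le[OF ws(1) q] qb(4) by (simp add: y_def)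
    then have "\<alpha> * (H_norm 3 y)\<^sup>2 \<le> \<alpha> * (2 * (H_norm 3 ws)\<^sup>2 + 12 * \<delta>\<^sup>2)"
      using \<alpha> by (intro mult_left_mono) auto
    also have "\<dots> = 2 * \<alpha> * (H_norm 3 ws)\<^sup>2 + \<alpha> * (12 * \<delta>\<^sup>2)" by (simp add: algebra_simps)
    also have "\<alpha> * (12 * \<delta>\<^sup>2) \<le> 12 * \<delta>\<^sup>2" using \<alpha> by (intro mult_left_le_one_le) auto
    finally show ?thesis by simp
  qed
  moreover have "(L2_norm (\<lambda>x. L_op a b w\<alpha> x - d x))\<^sup>2 + \<alpha> * (H_norm 3 w\<alpha>)\<^sup>2
      \<le> (L2_norm (\<lambda>x. L_op a b y x - d x))\<^sup>2 + \<alpha> * (H_norm 3 y)\<^sup>2"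
    using J_le by (simp add: J_def)
  moreover have "0 \<le> \<alpha> * (H_norm 3 w\<alpha>)\<^sup>2" using \<alpha> by simp
  moreover have "1 * \<delta>\<^sup>2 \<le> K\<^sup>2 * \<delta>\<^sup>2"
    using K1 by (intro mult_right_mono) auto
  ultimately show ?thesis unfolding power_mult_distrib by simp
qed

text \<open>The difference \<open>v\<close> of the minimizer and \<open>ws\<close> solves \<open>L v = (L w\<alpha> - d) + (d - ds)\<close> with
  initial values of size at most \<open>\<delta>\<close>, so the residual bound and the stability estimate combine.\<close>

lemma minimizer_error_bound:
  assumes a: "continuous_on {0..1} a" and b: "continuous_on {0..1} b"
    and d: "d \<in> L2" "ds \<in> L2" and \<alpha>: "0 < \<alpha>" "\<alpha> < 1"
    and ws: "ws \<in> H 3" "AE x in I01. L_op a b ws x = ds x" "cont_rep (weak_deriv 1 ws) 1 = 0"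
    and \<delta>: "L2_norm (\<lambda>x. d x - ds x) \<le> \<delta>" "cmod (p0 - cont_rep ws 0) \<le> \<delta>"
      "cmod (p1 - cont_rep (weak_deriv 1 ws) 0) \<le> \<delta>"
    and min: "is_arg_min (J a b d \<alpha>) (\<lambda>w. w \<in> W p0 p1) w\<alpha>"
  defines "K \<equiv> 1 + \<bar>Linf_norm a\<bar> + \<bar>Linf_norm b\<bar>"
  shows "H_norm 2 (\<lambda>x. w\<alpha> x - ws x) \<le> 25 * K\<^sup>2 * exp K * (\<delta> + sqrt \<alpha> * H_norm 3 ws)"
proof -
  define N where "N = H_norm 3 ws"
  have \<delta>0: "0 \<le> \<delta>" using \<delta>(2) norm_ge_zero order_trans by blast
  have K1: "1 \<le> K" by (simp add: K_def)
  have order_two_three: "(2::nat) \<le> 3" by simp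
  have N0: "0 \<le> N" by (simp add: N_def H_norm_nonneg)
  have w: "w\<alpha> \<in> H 3" "cont_rep w\<alpha> 0 = p0" "cont_rep (weak_deriv 1 w\<alpha>) 0 = p1"
    using min by (auto simp: is_arg_min_def W_def)
  define v where "v = (\<lambda>x. w\<alpha> x + (- 1) * ws x)"
  have v: "v \<in> H 3" unfolding v_def by (rule H_lincomb(1)[OF w(1) ws(1)])
  have v_eq: "(\<lambda>x. w\<alpha> x - ws x) = v" by (simp add: v_def)
  define m where "m = cmod (cont_rep v 0) + cmod (cont_rep (weak_deriv 1 v) 0) + L2_norm (L_op a b v)"
  have v_L2: "L_op a b v \<in> L2" by (rule L_op_L2[OF a b v]) simp
  have w_L2: "L_op a b w\<alpha> \<in> L2" by (rule L_op_L2[OF a b w(1)]) simp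
  have stab: "(L2_norm v)\<^sup>2 + (L2_norm (weak_deriv 1 v))\<^sup>2 + (L2_norm (weak_deriv 2 v))\<^sup>2
      \<le> 6 * K\<^sup>2 * (exp K)\<^sup>2 * m\<^sup>2"
    unfolding m_def K_def L_op_def
  proof (rule ODE_stability)
    show "AE x in I01. cmod (a x) \<le> \<bar>Linf_norm a\<bar>" "AE x in I01. cmod (b x) \<le> \<bar>Linf_norm b\<bar>"
      by (rule eventually_mono[OF AE_le_Linf_norm], rule a b, simp)+
    show "is_weak_deriv 1 (weak_deriv 1 v) (weak_deriv 2 v)"
      by (rule weak_deriv_1_weak_deriv_1[OF v]) simp
  qed (use weak_deriv_H[OF v, of 1] weak_deriv_H[OF v, of 2] H_imp_L2[OF v]
      continuous_measurable_I01[OF a] continuous_measurable_I01[OF b] in auto)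
  have "L2_norm (weak_deriv 0 v) = L2_norm v"
    by (rule weak_deriv_eq(3)[OF H_imp_L2[OF v] is_weak_deriv_0])
  moreover have "{..2::nat} = {0, 1, 2}" by auto
  ultimately have H2: "(H_norm 2 v)\<^sup>2 \<le> 6 * K\<^sup>2 * (exp K)\<^sup>2 * m\<^sup>2"
    using stab by (simp add: H_norm_power2)
  have traces: "cmod (cont_rep v 0) \<le> \<delta>" "cmod (cont_rep (weak_deriv 1 v) 0) \<le> \<delta>"
    using trace_lincomb[OF w(1) ws(1) order_two_three, of 0 "- 1"] \<delta> w(2,3) by (simp_all add: v_def)
  have F: "(L2_norm (L_op a b v))\<^sup>2 \<le> 46 * (K\<^sup>2 * \<delta>\<^sup>2) + 4 * (\<alpha> * N\<^sup>2)"
  proof -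
    have r: "(\<lambda>x. L_op a b w\<alpha> x - d x) \<in> L2" "(\<lambda>x. d x - ds x) \<in> L2"
      by (intro L2_diff w_L2 d)+
    have "AE x in I01. L_op a b v x = (L_op a b w\<alpha> x - d x) + (d x - ds x)"
      using ws(2) L_op_lincomb[OF w(1) ws(1) order_two_three, of a b "- 1"] unfolding v_def by eventually_elim simp
    then have "L2_norm (L_op a b v) = L2_norm (\<lambda>x. (L_op a b w\<alpha> x - d x) + (d x - ds x))"
      by (intro L2_norm_cong_AE L2_add(1) r v_L2)
    moreover have "(L2_norm (\<lambda>x. d x - ds x))\<^sup>2 \<le> \<delta>\<^sup>2"
      using \<delta>(1) by (simp add: power_mono L2_norm_nonneg)
    moreover have "1 * \<delta>\<^sup>2 \<le> K\<^sup>2 * \<delta>\<^sup>2"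
      using K1 by (intro mult_right_mono) auto
    moreover note minimizer_residual_bound[OF a b d \<alpha> ws \<delta> min, folded K_def N_def]
    ultimately show ?thesis using L2_add(2)[OF r] by (simp add: mult.assoc)
  qed
  have "m\<^sup>2 \<le> (2 * \<delta> + L2_norm (L_op a b v))\<^sup>2"
    using traces by (intro power_mono) (auto simp: m_def L2_norm_nonneg)
  also have "\<dots> \<le> 2 * (2 * \<delta>)\<^sup>2 + 2 * (L2_norm (L_op a b v))\<^sup>2"
    using norm_add_power2_le[of "2 * \<delta>" "L2_norm (L_op a b v)"] by simp
  also have "\<dots> \<le> 100 * (K\<^sup>2 * (\<delta>\<^sup>2 + \<alpha> * N\<^sup>2))"
  proof -
    have "1 * \<delta>\<^sup>2 \<le> K\<^sup>2 * \<delta>\<^sup>2" "1 * (\<alpha> * N\<^sup>2) \<le> K\<^sup>2 * (\<alpha> * N\<^sup>2)"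
      using K1 \<alpha> by (intro mult_right_mono; simp)+
    moreover have "0 \<le> K\<^sup>2 * (\<alpha> * N\<^sup>2)" using \<alpha> by simp
    ultimately show ?thesis using F by (simp add: power_mult_distrib distrib_left)
  qed
  also have "\<dots> \<le> 100 * (K\<^sup>2 * (\<delta> + sqrt \<alpha> * N)\<^sup>2)"
    using \<alpha> \<delta>0 N0 by (intro mult_left_mono) (simp_all add: power2_sum power_mult_distrib)
  finally have m2: "m\<^sup>2 \<le> 100 * (K\<^sup>2 * (\<delta> + sqrt \<alpha> * N)\<^sup>2)" .
  have "(H_norm 2 v)\<^sup>2 \<le> 6 * K\<^sup>2 * (exp K)\<^sup>2 * (100 * (K\<^sup>2 * (\<delta> + sqrt \<alpha> * N)\<^sup>2))"
    by (rule order_trans[OF H2 mult_left_mono[OF m2]]) simp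
  also have "\<dots> = 600 * (K\<^sup>2 * exp K * (\<delta> + sqrt \<alpha> * N))\<^sup>2"
    by (simp add: power2_eq_square)
  \<comment> \<open>Rounding up to the square of 25.\<close>
  also have "\<dots> \<le> 625 * (K\<^sup>2 * exp K * (\<delta> + sqrt \<alpha> * N))\<^sup>2"
    by (intro mult_right_mono) auto
  also have "\<dots> = (25 * K\<^sup>2 * exp K * (\<delta> + sqrt \<alpha> * N))\<^sup>2"
    by (simp add: power2_eq_square)
  finally have "H_norm 2 v \<le> 25 * K\<^sup>2 * exp K * (\<delta> + sqrt \<alpha> * N)"
  proof (rule power2_le_imp_le)
    have "0 \<le> \<delta> + sqrt \<alpha> * N" using \<alpha> \<delta>0 N0 by simp
    then show "0 \<le> 25 * K\<^sup>2 * exp K * (\<delta> + sqrt \<alpha> * N)" by simp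
  qed
  then show ?thesis unfolding v_eq N_def .
qed

theorem theorem3p2:
  shows "\<exists>C2 C2' :: real \<Rightarrow> real \<Rightarrow> real. (\<forall>A B. 0 < C2 A B \<and> 0 < C2' A B) \<and>
    (\<forall>(a :: real \<Rightarrow> complex) (b :: real \<Rightarrow> complex) (d :: real \<Rightarrow> complex) (ds :: real \<Rightarrow> complex)
      (p0 :: complex) (p1 :: complex) (p0s :: complex) (p1s :: complex)
      (\<alpha> :: real) (\<delta> :: real) (ws :: real \<Rightarrow> complex) (w\<alpha> :: real \<Rightarrow> complex).
        continuous_on {0..1} a \<longrightarrow> continuous_on {0..1} b \<longrightarrow>
        d \<in> L2 \<longrightarrow> ds \<in> L2 \<longrightarrow>
        0 < \<alpha> \<longrightarrow> \<alpha> < 1 \<longrightarrow> 0 < \<delta> \<longrightarrow> \<delta> < 1 \<longrightarrow>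
        ws \<in> H 3 \<longrightarrow>
        (AE x in I01. L_op a b ws x = ds x) \<longrightarrow>
        cont_rep ws 0 = p0s \<longrightarrow>
        cont_rep (weak_deriv 1 ws) 0 = p1s \<longrightarrow>
        cont_rep (weak_deriv 1 ws) 1 = 0 \<longrightarrow>
        Max {L2_norm (\<lambda>x. d x - ds x), cmod (p0 - p0s), cmod (p1 - p1s)} \<le> \<delta> \<longrightarrow>
        is_arg_min (J a b d \<alpha>) (\<lambda>w. w \<in> W p0 p1) w\<alpha> \<longrightarrow>
          H_norm 2 (\<lambda>x. w\<alpha> x - ws x)
            \<le> C2 (Linf_norm a) (Linf_norm b) * (\<delta> + sqrt \<alpha> + sqrt \<alpha> * H_norm 3 ws) \<and>
          (\<alpha> = \<delta>\<^sup>2 \<longrightarrow>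
            H_norm 2 (\<lambda>x. w\<alpha> x - ws x)
              \<le> C2' (Linf_norm a) (Linf_norm b) * (1 + H_norm 3 ws) * \<delta>))"
proof -
  define C where "C A B = 25 * (1 + \<bar>A\<bar> + \<bar>B\<bar>)\<^sup>2 * exp (1 + \<bar>A\<bar> + \<bar>B\<bar>)" for A B :: real
  have C_pos: "0 < C A B" for A B
    by (auto simp: C_def intro!: mult_pos_pos zero_less_power add_pos_nonneg)
  show ?thesis
  proof (rule exI[of _ C], rule exI[of _ C], intro conjI allI impI)
    fix a b d ds :: "real \<Rightarrow> complex" and p0 p1 p0s p1s :: complex and \<alpha> \<delta> :: real
      and ws w\<alpha> :: "real \<Rightarrow> complex"
    assume a: "continuous_on {0..1} a" and b: "continuous_on {0..1} b"
      and d: "d \<in> L2" "ds \<in> L2" and \<alpha>: "0 < \<alpha>" "\<alpha> < 1" and \<delta>: "0 < \<delta>" "\<delta> < 1"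
      and ws: "ws \<in> H 3" "AE x in I01. L_op a b ws x = ds x"
        "cont_rep ws 0 = p0s" "cont_rep (weak_deriv 1 ws) 0 = p1s" "cont_rep (weak_deriv 1 ws) 1 = 0"
      and Max: "Max {L2_norm (\<lambda>x. d x - ds x), cmod (p0 - p0s), cmod (p1 - p1s)} \<le> \<delta>"
      and min: "is_arg_min (J a b d \<alpha>) (\<lambda>w. w \<in> W p0 p1) w\<alpha>"
    let ?e = "H_norm 2 (\<lambda>x. w\<alpha> x - ws x)" and ?C = "C (Linf_norm a) (Linf_norm b)"
    have e: "?e \<le> ?C * (\<delta> + sqrt \<alpha> * H_norm 3 ws)"
      unfolding C_def
      by (rule minimizer_error_bound[OF a b d \<alpha> ws(1,2,5) _ _ _ min]) (use Max ws(3,4) in auto)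
    also have "\<dots> \<le> ?C * (\<delta> + sqrt \<alpha> + sqrt \<alpha> * H_norm 3 ws)"
      using C_pos[of "Linf_norm a" "Linf_norm b"] \<alpha> by (intro mult_left_mono) auto
    finally show "?e \<le> ?C * (\<delta> + sqrt \<alpha> + sqrt \<alpha> * H_norm 3 ws)" .
    assume "\<alpha> = \<delta>\<^sup>2"
    then show "?e \<le> ?C * (1 + H_norm 3 ws) * \<delta>"
      using e \<delta> by (simp add: algebra_simps)
  qed (use C_pos in auto)
qed

end
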